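(* Let $\theta=(\theta_{j,k})_{j,k\in\mathbb{Z}}$ be an upper triangular matrix with $\theta_{j,k}\in[0,1)$ for $j<k$ and $\theta_{j,k}=0$ for $j\ge k$, and assume that $\theta$ is constant on its diagonals, i.e. $\theta_{j,k}=\theta_{k-j}$ for $j<k$, for some sequence $(\theta_m)_{m\ge1}$ in $[0,1)$. Let $\sigma_\theta$ be the 2-cocycle on $\bigoplus_{\mathbb{Z}}\mathbb{Z}$ given by $\sigma_\theta((x_j)_j,(y_j)_j)=\prod_{j<k}e^{2\pi i\theta_{j,k}x_jy_k}$, and let $\check\sigma_\theta$ be the 2-cocycle on $\mathbb{Z}\wr\mathbb{Z}$ given by $\check\sigma_\theta\big(((x_j)_j,n),((y_j)_j,n')\big)=\sigma_\theta\big((x_j)_j,n\cdot(y_j)_j\big)$. Then $(\mathbb{Z}\wr\mathbb{Z},\check\sigma_\theta)$ has the unique trace property if and only if $(\bigoplus_{\mathbb{Z}}\mathbb{Z},\sigma_\theta)$ satisfies Kleppner's condition, which implies that $(\mathbb{Z}\wr\mathbb{Z},\check\sigma_\theta)$ is $C^*$-simple.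
   Context: The wreath product $\mathbb{Z}\wr\mathbb{Z}$ is the semidirect product $(\bigoplus_{\mathbb{Z}}\mathbb{Z})\rtimes\mathbb{Z}$ with $(n\cdot(x_j)_{j\in\mathbb{Z}})_k=x_{k-n}$. For a discrete group $G$ with identity $e$, a (normalized) 2-cocycle is a map $\sigma:G\times G\to\mathbb{T}$ with $\sigma(g,e)=\sigma(e,g)=1$ and $\sigma(g,h)\sigma(gh,k)=\sigma(h,k)\sigma(g,hk)$ for all $g,h,k$. With $(\lambda_\sigma(g)\xi)(h)=\sigma(g,g^{-1}h)\xi(g^{-1}h)$ on $\ell^2(G)$, $C_r^*(G,\sigma)$ is the C$^*$-algebra generated by $\lambda_\sigma(G)$. $(G,\sigma)$ is $C^*$-simple if $C_r^*(G,\sigma)$ is simple, and has the unique trace property if $C_r^*(G,\sigma)$ has a unique tracial state. An element $g\in G$ is $\sigma$-regular if $\sigma(g,h)=\sigma(h,g)$ whenever $h\in G$ commutes with $g$; $(G,\sigma)$ satisfies Kleppner's condition if every nontrivial $\sigma$-regular conjugacy class of $G$ is infinite. *)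

theory Defs
  imports
    "HOL-Analysis.Analysis"
    "HOL-Library.Poly_Mapping"
    "HOL-Library.Nonpos_Ints"
begin

text \<open>
  Discrete groups are types of class \<^class>\<open>group_add\<close>, which does not assume commutativity:
  the group law is written \<open>+\<close>, the identity \<open>0\<close>, and the inverse of \<open>g\<close> is \<open>- g\<close>.
\<close>

section \<open>The Hilbert space of square-summable functions\<close>

lemma square_summable_mult:
  fixes f g :: "'a \<Rightarrow> complex"
  assumes "(\<lambda>x. (cmod (f x))\<^sup>2) summable_on A" "(\<lambda>x. (cmod (g x))\<^sup>2) summable_on A"
  shows "(\<lambda>x. f x * cnj (g x)) summable_on A"
proof -
  have "(\<lambda>x. (cmod (f x))\<^sup>2 + (cmod (g x))\<^sup>2) summable_on A"
    by (rule summable_on_add[OF assms])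
  then have "(\<lambda>x. norm (f x * cnj (g x))) summable_on A"
  proof (rule summable_on_comparison_test)
    fix x
    have "0 \<le> (cmod (f x) - cmod (g x))\<^sup>2" "0 \<le> cmod (f x) * cmod (g x)" by auto
    then show "norm (f x * cnj (g x)) \<le> (cmod (f x))\<^sup>2 + (cmod (g x))\<^sup>2"
      unfolding norm_mult complex_mod_cnj power2_diff by linarith
  qed auto
  then show ?thesis by (rule abs_summable_summable)
qed

lemma square_summable_add:
  fixes f g :: "'a \<Rightarrow> complex"
  assumes "(\<lambda>x. (cmod (f x))\<^sup>2) summable_on A" "(\<lambda>x. (cmod (g x))\<^sup>2) summable_on A"
  shows "(\<lambda>x. (cmod (f x + g x))\<^sup>2) summable_on A"
proof -
  have "(\<lambda>x. 2 * (cmod (f x))\<^sup>2 + 2 * (cmod (g x))\<^sup>2) summable_on A"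
    by (intro summable_on_add summable_on_cmult_right assms)
  then show ?thesis
  proof (rule summable_on_comparison_test)
    fix x
    have "(cmod (f x + g x))\<^sup>2 \<le> (cmod (f x) + cmod (g x))\<^sup>2"
      by (intro power_mono norm_triangle_ineq) auto
    also have "\<dots> \<le> 2 * (cmod (f x))\<^sup>2 + 2 * (cmod (g x))\<^sup>2"
      using zero_le_power2[of "cmod (f x) - cmod (g x)"] by (simp add: power2_diff power2_sum)
    finally show "(cmod (f x + g x))\<^sup>2 \<le> 2 * (cmod (f x))\<^sup>2 + 2 * (cmod (g x))\<^sup>2" .
  qed auto
qed

lemma square_summable_cmult:
  fixes f :: "'a \<Rightarrow> complex"
  assumes "(\<lambda>x. (cmod (f x))\<^sup>2) summable_on A"
  shows "(\<lambda>x. (cmod (c * f x))\<^sup>2) summable_on A"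
  using summable_on_cmult_right[OF assms, of "(cmod c)\<^sup>2"] by (simp add: norm_mult power_mult_distrib)

typedef 'a ell2 = "{f :: 'a \<Rightarrow> complex. (\<lambda>x. (cmod (f x))\<^sup>2) summable_on UNIV}"
  morphisms ell2_apply Abs_ell2
  by (rule exI[of _ "\<lambda>_. 0"]) simp

setup_lifting type_definition_ell2

lemma ell2_eqI: "(\<And>x. ell2_apply \<xi> x = ell2_apply \<eta> x) \<Longrightarrow> \<xi> = \<eta>"
  by transfer auto

lift_definition ell2_scale :: "complex \<Rightarrow> 'a ell2 \<Rightarrow> 'a ell2" is "\<lambda>c f x. c * f x"
  by (rule square_summable_cmult)

lift_definition ell2_cinner :: "'a ell2 \<Rightarrow> 'a ell2 \<Rightarrow> complex"
  is "\<lambda>f g. \<Sum>\<^sub>\<infinity>x. f x * cnj (g x)" .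

instantiation ell2 :: (type) real_vector
begin

lift_definition zero_ell2 :: "'a ell2" is "\<lambda>_. 0" by simp
lift_definition plus_ell2 :: "'a ell2 \<Rightarrow> 'a ell2 \<Rightarrow> 'a ell2" is "\<lambda>f g x. f x + g x"
  by (rule square_summable_add)
lift_definition uminus_ell2 :: "'a ell2 \<Rightarrow> 'a ell2" is "\<lambda>f x. - f x" by simp
definition minus_ell2 :: "'a ell2 \<Rightarrow> 'a ell2 \<Rightarrow> 'a ell2" where "minus_ell2 \<xi> \<eta> = \<xi> + (- \<eta>)"
definition scaleR_ell2 :: "real \<Rightarrow> 'a ell2 \<Rightarrow> 'a ell2" where
  "scaleR_ell2 r = ell2_scale (complex_of_real r)"

instance
  by standard
    (simp_all add: ell2_eqI minus_ell2_def scaleR_ell2_def plus_ell2.rep_eq zero_ell2.rep_eq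
      uminus_ell2.rep_eq ell2_scale.rep_eq algebra_simps)

end

lemma ell2_cinner_summable:
  "(\<lambda>x. ell2_apply \<xi> x * cnj (ell2_apply \<eta> x)) summable_on UNIV"
  by transfer (rule square_summable_mult)

lemma ell2_cinner_add_left: "ell2_cinner (\<xi> + \<eta>) \<zeta> = ell2_cinner \<xi> \<zeta> + ell2_cinner \<eta> \<zeta>"
  using infsum_add[OF ell2_cinner_summable[of \<xi> \<zeta>] ell2_cinner_summable[of \<eta> \<zeta>]]
  by (simp add: ell2_cinner.rep_eq plus_ell2.rep_eq distrib_right)

lemma ell2_cinner_scale_left: "ell2_cinner (ell2_scale c \<xi>) \<eta> = c * ell2_cinner \<xi> \<eta>"
  using infsum_cmult_right[OF ell2_cinner_summable[of \<xi> \<eta>], of c]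
  by (simp add: ell2_cinner.rep_eq ell2_scale.rep_eq mult.assoc)

lemma ell2_cinner_cnj: "cnj (ell2_cinner \<xi> \<eta>) = ell2_cinner \<eta> \<xi>"
  by (simp add: ell2_cinner.rep_eq flip: infsum_cnj) (simp add: mult.commute)

lemma ell2_cinner_self:
  "ell2_cinner \<xi> \<xi> = complex_of_real (\<Sum>\<^sub>\<infinity>x. (cmod (ell2_apply \<xi> x))\<^sup>2)"
proof -
  have "(\<lambda>x. (cmod (ell2_apply \<xi> x))\<^sup>2) summable_on UNIV" using ell2_apply[of \<xi>] by simp
  then have "((\<lambda>x. complex_of_real ((cmod (ell2_apply \<xi> x))\<^sup>2)) has_sum
      complex_of_real (\<Sum>\<^sub>\<infinity>x. (cmod (ell2_apply \<xi> x))\<^sup>2)) UNIV"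
    by (intro has_sum_of_real has_sum_infsum)
  then show ?thesis
    unfolding ell2_cinner.rep_eq complex_norm_square by (rule infsumI)
qed

instantiation ell2 :: (type) real_inner
begin

definition inner_ell2 :: "'a ell2 \<Rightarrow> 'a ell2 \<Rightarrow> real" where
  "inner_ell2 \<xi> \<eta> = Re (ell2_cinner \<xi> \<eta>)"
definition norm_ell2 :: "'a ell2 \<Rightarrow> real" where "norm_ell2 \<xi> = sqrt (inner \<xi> \<xi>)"
definition dist_ell2 :: "'a ell2 \<Rightarrow> 'a ell2 \<Rightarrow> real" where "dist_ell2 \<xi> \<eta> = norm (\<xi> - \<eta>)"
definition sgn_ell2 :: "'a ell2 \<Rightarrow> 'a ell2" where "sgn_ell2 \<xi> = \<xi> /\<^sub>R norm \<xi>"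
definition uniformity_ell2 :: "('a ell2 \<times> 'a ell2) filter" where
  "uniformity_ell2 = (INF e\<in>{0<..}. principal {(x, y). dist x y < e})"
definition open_ell2 :: "'a ell2 set \<Rightarrow> bool" where
  "open_ell2 U \<longleftrightarrow> (\<forall>x\<in>U. \<forall>\<^sub>F (x', y) in uniformity. x' = x \<longrightarrow> y \<in> U)"

instance
proof
  fix x y z :: "'a ell2" and r :: real and U :: "'a ell2 set"
  show "dist x y = norm (x - y)" "sgn x = x /\<^sub>R norm x" "norm x = sqrt (inner x x)"
    by (fact dist_ell2_def sgn_ell2_def norm_ell2_def)+
  show "uniformity = (INF e\<in>{0<..}. principal {(x :: 'a ell2, y). dist x y < e})"
    by (fact uniformity_ell2_def)
  show "open U \<longleftrightarrow> (\<forall>x\<in>U. \<forall>\<^sub>F (x', y) in uniformity. x' = x \<longrightarrow> y \<in> U)"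
    by (fact open_ell2_def)
  show "inner x y = inner y x"
    unfolding inner_ell2_def by (metis ell2_cinner_cnj cnj.sel(1))
  show "inner (x + y) z = inner x z + inner y z"
    by (simp add: inner_ell2_def ell2_cinner_add_left)
  show "inner (r *\<^sub>R x) y = r * inner x y"
    by (simp add: inner_ell2_def scaleR_ell2_def ell2_cinner_scale_left)
  show "0 \<le> inner x x"
    by (simp add: inner_ell2_def ell2_cinner_self infsum_nonneg)
  show "inner x x = 0 \<longleftrightarrow> x = 0"
  proof
    assume "inner x x = 0"
    then have "(\<Sum>\<^sub>\<infinity>i. (cmod (ell2_apply x i))\<^sup>2) = 0"
      by (simp add: inner_ell2_def ell2_cinner_self)
    then have "(cmod (ell2_apply x i))\<^sup>2 = 0" for i
      using ell2_apply[of x]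
      by (intro nonneg_infsum_le_0D[of "\<lambda>i. (cmod (ell2_apply x i))\<^sup>2" UNIV]) auto
    then show "x = 0" by (intro ell2_eqI) (simp add: zero_ell2.rep_eq)
  next
    assume "x = 0"
    then show "inner x x = 0" by (simp add: inner_ell2_def ell2_cinner.rep_eq zero_ell2.rep_eq)
  qed
qed

end

lemma norm_ell2_square: "(norm \<xi>)\<^sup>2 = (\<Sum>\<^sub>\<infinity>x. (cmod (ell2_apply \<xi> x))\<^sup>2)"
  by (simp add: norm_ell2_def inner_ell2_def ell2_cinner_self infsum_nonneg)

lemma norm_ell2_scale: "norm (ell2_scale c \<xi>) = cmod c * norm \<xi>"
proof -
  have "(norm (ell2_scale c \<xi>))\<^sup>2 = (cmod c * norm \<xi>)\<^sup>2"
    using infsum_cmult_right'[of "(cmod c)\<^sup>2" "\<lambda>x. (cmod (ell2_apply \<xi> x))\<^sup>2" UNIV]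
    by (simp add: norm_ell2_square power_mult_distrib ell2_scale.rep_eq norm_mult)
  then show ?thesis by (simp add: power2_eq_iff_nonneg)
qed

section \<open>Algebras of bounded operators\<close>

text \<open>
  The library's bounded linear maps are only real-linear; \<open>B(\<ell>\<^sup>2)\<close> consists of those that commute
  with complex scalars. Its operator norm is the norm of the library's type.
\<close>

type_synonym 'a ell2_op = "'a ell2 \<Rightarrow>\<^sub>L 'a ell2"

lift_definition scalar_op :: "complex \<Rightarrow> 'a ell2_op" is ell2_scale
proof (rule bounded_linear_intro)
  fix c r and x y :: "'a ell2"
  show "ell2_scale c (x + y) = ell2_scale c x + ell2_scale c y"
    by transfer (simp add: algebra_simps)
  show "ell2_scale c (r *\<^sub>R x) = r *\<^sub>R ell2_scale c x"
    unfolding scaleR_ell2_def by transfer (simp add: algebra_simps)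
  show "norm (ell2_scale c x) \<le> norm x * cmod c"
    by (simp add: norm_ell2_scale mult.commute)
qed

definition op_scale :: "complex \<Rightarrow> 'a ell2_op \<Rightarrow> 'a ell2_op" where
  "op_scale c T = scalar_op c o\<^sub>L T"

definition bounded_ops :: "'a ell2_op set" where
  "bounded_ops = {T. \<forall>c \<xi>. blinfun_apply T (ell2_scale c \<xi>) = ell2_scale c (blinfun_apply T \<xi>)}"

text \<open>
  The adjoint is used as a relation: since \<open>\<ell>\<^sup>2\<close> is complete, every \<open>T \<in> bounded_ops\<close> has exactly one
  \<open>S\<close> with \<open>adjoint_of T S\<close>.
\<close>

definition adjoint_of :: "'a ell2_op \<Rightarrow> 'a ell2_op \<Rightarrow> bool" where
  "adjoint_of T S \<longleftrightarrow> (\<forall>\<xi> \<eta>. ell2_cinner (T \<xi>) \<eta> = ell2_cinner \<xi> (S \<eta>))"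

definition complex_subspace :: "'a ell2_op set \<Rightarrow> bool" where
  "complex_subspace V \<longleftrightarrow>
     0 \<in> V \<and> (\<forall>S\<in>V. \<forall>T\<in>V. S + T \<in> V) \<and> (\<forall>c. \<forall>T\<in>V. op_scale c T \<in> V)"

definition cstar_subalgebra :: "'a ell2_op set \<Rightarrow> bool" where
  "cstar_subalgebra A \<longleftrightarrow>
     A \<subseteq> bounded_ops \<and> complex_subspace A \<and> closed A \<and>
     (\<forall>S\<in>A. \<forall>T\<in>A. S o\<^sub>L T \<in> A) \<and>
     (\<forall>T\<in>A. \<forall>S. adjoint_of T S \<longrightarrow> S \<in> A)"

definition closed_ideal :: "'a ell2_op set \<Rightarrow> 'a ell2_op set \<Rightarrow> bool" where
  "closed_ideal A I \<longleftrightarrow>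
     I \<subseteq> A \<and> complex_subspace I \<and> closed I \<and>
     (\<forall>S\<in>A. \<forall>T\<in>I. S o\<^sub>L T \<in> I \<and> T o\<^sub>L S \<in> I)"

definition simple_cstar :: "'a ell2_op set \<Rightarrow> bool" where
  "simple_cstar A \<longleftrightarrow> A \<noteq> {0} \<and> (\<forall>I. closed_ideal A I \<longrightarrow> I = {0} \<or> I = A)"

text \<open>
  Tracial states of an algebra containing the identity operator. A functional is given by a total
  function on operators, of which only the values on \<open>A\<close> matter. A state is a positive linear
  functional that takes the value 1 at the identity.
\<close>

definition tracial_state :: "'a ell2_op set \<Rightarrow> ('a ell2_op \<Rightarrow> complex) \<Rightarrow> bool" where
  "tracial_state A \<tau> \<longleftrightarrow>
     (\<forall>S\<in>A. \<forall>T\<in>A. \<tau> (S + T) = \<tau> S + \<tau> T) \<and>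
     (\<forall>c. \<forall>T\<in>A. \<tau> (op_scale c T) = c * \<tau> T) \<and>
     (\<forall>T\<in>A. \<forall>S\<in>A. adjoint_of T S \<longrightarrow> \<tau> (S o\<^sub>L T) \<in> \<real>\<^sub>\<ge>\<^sub>0) \<and>
     \<tau> id_blinfun = 1 \<and>
     (\<forall>S\<in>A. \<forall>T\<in>A. \<tau> (S o\<^sub>L T) = \<tau> (T o\<^sub>L S))"

definition has_unique_tracial_state :: "'a ell2_op set \<Rightarrow> bool" where
  "has_unique_tracial_state A \<longleftrightarrow>
     (\<exists>\<tau>. tracial_state A \<tau> \<and> (\<forall>\<tau>'. tracial_state A \<tau>' \<longrightarrow> (\<forall>T\<in>A. \<tau>' T = \<tau> T)))"

section \<open>Reduced twisted group algebras\<close>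

definition cocycle :: "('g::group_add \<Rightarrow> 'g \<Rightarrow> complex) \<Rightarrow> bool" where
  "cocycle \<sigma> \<longleftrightarrow>
     (\<forall>g h. cmod (\<sigma> g h) = 1) \<and>
     (\<forall>g. \<sigma> g 0 = 1 \<and> \<sigma> 0 g = 1) \<and>
     (\<forall>g h k. \<sigma> g h * \<sigma> (g + h) k = \<sigma> h k * \<sigma> g (h + k))"

text \<open>
  The values of \<^const>\<open>Abs_ell2\<close> and \<^const>\<open>Blinfun\<close> below are meaningful when \<open>\<sigma>\<close> is a
  2-cocycle; see \<open>ell2_apply_twisted_reg\<close>.
\<close>

definition twisted_reg :: "('g::group_add \<Rightarrow> 'g \<Rightarrow> complex) \<Rightarrow> 'g \<Rightarrow> 'g ell2_op" where
  "twisted_reg \<sigma> g =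
     Blinfun (\<lambda>\<xi>. Abs_ell2 (\<lambda>h. \<sigma> g (- g + h) * ell2_apply \<xi> (- g + h)))"

definition reduced_cstar :: "('g::group_add \<Rightarrow> 'g \<Rightarrow> complex) \<Rightarrow> 'g ell2_op set" where
  "reduced_cstar \<sigma> = cstar_subalgebra hull (range (twisted_reg \<sigma>))"

definition cstar_simple :: "('g::group_add \<Rightarrow> 'g \<Rightarrow> complex) \<Rightarrow> bool" where
  "cstar_simple \<sigma> \<longleftrightarrow> simple_cstar (reduced_cstar \<sigma>)"

definition unique_trace_property :: "('g::group_add \<Rightarrow> 'g \<Rightarrow> complex) \<Rightarrow> bool" where
  "unique_trace_property \<sigma> \<longleftrightarrow> has_unique_tracial_state (reduced_cstar \<sigma>)"

definition regular_element :: "('g::group_add \<Rightarrow> 'g \<Rightarrow> complex) \<Rightarrow> 'g \<Rightarrow> bool" where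
  "regular_element \<sigma> g \<longleftrightarrow> (\<forall>h. g + h = h + g \<longrightarrow> \<sigma> g h = \<sigma> h g)"

definition conjugacy_class :: "'g::group_add \<Rightarrow> 'g set" where
  "conjugacy_class g = {h + g - h | h. True}"

definition kleppner :: "('g::group_add \<Rightarrow> 'g \<Rightarrow> complex) \<Rightarrow> bool" where
  "kleppner \<sigma> \<longleftrightarrow> (\<forall>g. g \<noteq> 0 \<and> regular_element \<sigma> g \<longrightarrow> infinite (conjugacy_class g))"

context
  fixes \<sigma> :: "'g::group_add \<Rightarrow> 'g \<Rightarrow> complex"
  assumes cocycle: "cocycle \<sigma>"
begin

lemma bij_left_translation: "bij (\<lambda>h. - g + h :: 'g)"
  by (rule bij_betw_byWitness[where f' = "\<lambda>h. g + h"]) (auto simp: add.assoc[symmetric])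

lemma twisted_translate_square:
  "(cmod (\<sigma> g (- g + h) * ell2_apply \<xi> (- g + h)))\<^sup>2 = (cmod (ell2_apply \<xi> (- g + h)))\<^sup>2"
  using cocycle by (simp add: cocycle_def norm_mult)

lemma ell2_apply_twisted_translate:
  "ell2_apply (Abs_ell2 (\<lambda>h. \<sigma> g (- g + h) * ell2_apply \<xi> (- g + h))) h =
     \<sigma> g (- g + h) * ell2_apply \<xi> (- g + h)"
proof -
  have "(\<lambda>h. (cmod (ell2_apply \<xi> (- g + h)))\<^sup>2) summable_on UNIV"
    using ell2_apply[of \<xi>]
      summable_on_reindex_bij_betw[OF bij_left_translation, of "\<lambda>h. (cmod (ell2_apply \<xi> h))\<^sup>2"]
    by simp
  then show ?thesis by (subst Abs_ell2_inverse) (auto simp: twisted_translate_square)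
qed

lemma bounded_linear_twisted_translate:
  "bounded_linear (\<lambda>\<xi>. Abs_ell2 (\<lambda>h. \<sigma> g (- g + h) * ell2_apply \<xi> (- g + h)))"
proof (rule bounded_linear_intro[where K = 1])
  fix r and \<xi> \<eta> :: "'g ell2"
  let ?L = "\<lambda>\<xi>. Abs_ell2 (\<lambda>h. \<sigma> g (- g + h) * ell2_apply \<xi> (- g + h))"
  show "?L (\<xi> + \<eta>) = ?L \<xi> + ?L \<eta>"
    by (rule ell2_eqI)
      (simp only: ell2_apply_twisted_translate,
        simp add: ell2_apply_twisted_translate plus_ell2.rep_eq distrib_left)
  show "?L (r *\<^sub>R \<xi>) = r *\<^sub>R ?L \<xi>"
    by (rule ell2_eqI)
      (simp only: ell2_apply_twisted_translate,
        simp add: ell2_apply_twisted_translate scaleR_ell2_def ell2_scale.rep_eq)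
  have "(norm (?L \<xi>))\<^sup>2 = (norm \<xi>)\<^sup>2"
    using infsum_reindex_bij_betw[OF bij_left_translation, of "\<lambda>h. (cmod (ell2_apply \<xi> h))\<^sup>2"]
    by (simp add: norm_ell2_square ell2_apply_twisted_translate twisted_translate_square)
  then show "norm (?L \<xi>) \<le> norm \<xi> * 1" by (simp add: power2_eq_iff_nonneg)
qed

lemma ell2_apply_twisted_reg:
  "ell2_apply (twisted_reg \<sigma> g \<xi>) h = \<sigma> g (- g + h) * ell2_apply \<xi> (- g + h)"
  by (simp add: twisted_reg_def bounded_linear_Blinfun_apply bounded_linear_twisted_translate
      ell2_apply_twisted_translate)

lemma twisted_reg_bounded_ops: "twisted_reg \<sigma> g \<in> bounded_ops"
  by (auto simp: bounded_ops_def ell2_apply_twisted_reg ell2_scale.rep_eq intro!: ell2_eqI)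

lemma id_in_reduced_cstar: "id_blinfun \<in> reduced_cstar \<sigma>"
proof -
  have "twisted_reg \<sigma> 0 = id_blinfun"
    using cocycle
    by (intro blinfun_eqI ell2_eqI) (simp add: ell2_apply_twisted_reg cocycle_def)
  moreover have "twisted_reg \<sigma> 0 \<in> reduced_cstar \<sigma>"
    unfolding reduced_cstar_def by (rule hull_inc) simp
  ultimately show ?thesis by simp
qed

end

section \<open>The wreath product\<close>

type_synonym int_sum = "int \<Rightarrow>\<^sub>0 int"

definition shift :: "int \<Rightarrow> int_sum \<Rightarrow> int_sum" where
  "shift n x = Poly_Mapping.map_key (\<lambda>k. k - n) x"

lemma lookup_shift [simp]: "Poly_Mapping.lookup (shift n x) k = Poly_Mapping.lookup x (k - n)"
  by (simp add: shift_def Poly_Mapping.map_key.rep_eq inj_def)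

lemma shift_add: "shift n (x + y) = shift n x + shift n y"
  and shift_uminus: "shift n (- x) = - shift n x"
  and shift_shift: "shift n (shift m x) = shift (n + m) x"
  and shift_by_0 [simp]: "shift 0 x = x"
  and shift_0 [simp]: "shift n 0 = 0"
  by (rule poly_mapping_eqI, simp add: lookup_add algebra_simps)+

datatype wreath = Wreath (wreath_base: int_sum) (wreath_top: int)

instantiation wreath :: group_add
begin

definition zero_wreath :: wreath where "0 = Wreath 0 0"
definition plus_wreath :: "wreath \<Rightarrow> wreath \<Rightarrow> wreath" where
  "a + b = Wreath (wreath_base a + shift (wreath_top a) (wreath_base b))
     (wreath_top a + wreath_top b)"
definition uminus_wreath :: "wreath \<Rightarrow> wreath" where
  "- a = Wreath (shift (- wreath_top a) (- wreath_base a)) (- wreath_top a)"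
definition minus_wreath :: "wreath \<Rightarrow> wreath \<Rightarrow> wreath" where "a - b = a + (- b :: wreath)"

instance
  by standard
    (auto simp: zero_wreath_def plus_wreath_def uminus_wreath_def minus_wreath_def
      shift_add shift_shift shift_uminus add.assoc intro!: wreath.expand)

end

text \<open>
  In the product over \<open>j < k\<close> the factors with \<open>x\<^sub>j = 0\<close> or \<open>y\<^sub>k = 0\<close> are equal to 1 and are
  omitted, which makes it a product over a finite set.
\<close>

definition base_cocycle :: "(int \<Rightarrow> int \<Rightarrow> real) \<Rightarrow> int_sum \<Rightarrow> int_sum \<Rightarrow> complex" where
  "base_cocycle \<theta> x y =
     (\<Prod>(j, k) \<in> {(j, k). j \<in> Poly_Mapping.keys x \<and> k \<in> Poly_Mapping.keys y \<and> j < k}.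
       exp (2 * of_real pi * \<i> * of_real (\<theta> j k) *
         of_int (Poly_Mapping.lookup x j) * of_int (Poly_Mapping.lookup y k)))"

definition wreath_cocycle :: "(int \<Rightarrow> int \<Rightarrow> real) \<Rightarrow> wreath \<Rightarrow> wreath \<Rightarrow> complex" where
  "wreath_cocycle \<theta> a b =
     base_cocycle \<theta> (wreath_base a) (shift (wreath_top a) (wreath_base b))"

lemma base_cocycle_eq_prod:
  assumes "finite K" "Poly_Mapping.keys x \<subseteq> K" "Poly_Mapping.keys y \<subseteq> K"
  shows "base_cocycle \<theta> x y = (\<Prod>(j, k) \<in> {(j, k) \<in> K \<times> K. j < k}.
       exp (2 * of_real pi * \<i> * of_real (\<theta> j k) *
         of_int (Poly_Mapping.lookup x j) * of_int (Poly_Mapping.lookup y k)))"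
proof -
  have fin: "finite {(j, k) \<in> K \<times> K. j < k}"
    by (rule finite_subset[of _ "K \<times> K"]) (use assms in auto)
  show ?thesis
    unfolding base_cocycle_def
    by (rule prod.mono_neutral_left[OF fin]) (use assms in \<open>auto simp: in_keys_iff\<close>)
qed

lemma base_cocycle_add_left:
  "base_cocycle \<theta> (x + y) z = base_cocycle \<theta> x z * base_cocycle \<theta> y z" (is ?left)
  and base_cocycle_add_right:
  "base_cocycle \<theta> z (x + y) = base_cocycle \<theta> z x * base_cocycle \<theta> z y" (is ?right)
proof -
  let ?K = "Poly_Mapping.keys x \<union> Poly_Mapping.keys y \<union> Poly_Mapping.keys z"
  have K: "finite ?K" "Poly_Mapping.keys x \<subseteq> ?K" "Poly_Mapping.keys y \<subseteq> ?K"
      "Poly_Mapping.keys z \<subseteq> ?K" "Poly_Mapping.keys (x + y) \<subseteq> ?K"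
    using Poly_Mapping.keys_add[of x y] by auto
  show ?left
    by (simp add: base_cocycle_eq_prod[OF K(1)] K(2-) prod.distrib[symmetric] lookup_add
        exp_add[symmetric] distrib_left distrib_right case_prod_unfold del: Un_iff)
  show ?right
    by (simp add: base_cocycle_eq_prod[OF K(1)] K(2-) prod.distrib[symmetric] lookup_add
        exp_add[symmetric] distrib_left distrib_right case_prod_unfold del: Un_iff)
qed

lemma base_cocycle_0 [simp]: "base_cocycle \<theta> x 0 = 1" "base_cocycle \<theta> 0 x = 1"
  by (simp_all add: base_cocycle_def)

lemma norm_base_cocycle: "cmod (base_cocycle \<theta> x y) = 1"
  by (simp add: base_cocycle_def prod_norm[symmetric] case_prod_unfold)

lemma cocycle_base_cocycle: "cocycle (base_cocycle \<theta>)"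
  by (simp add: cocycle_def norm_base_cocycle base_cocycle_add_left base_cocycle_add_right)

lemma base_cocycle_shift:
  assumes "\<And>j k. j < k \<Longrightarrow> \<theta> j k = t (nat (k - j))"
  shows "base_cocycle \<theta> (shift n x) (shift n y) = base_cocycle \<theta> x y"
  unfolding base_cocycle_def
  by (rule prod.reindex_bij_witness[where i = "\<lambda>(j, k). (j + n, k + n)"
        and j = "\<lambda>(j, k). (j - n, k - n)"])
    (auto simp: in_keys_iff assms)

lemma cocycle_wreath_cocycle:
  assumes "\<And>j k. j < k \<Longrightarrow> \<theta> j k = t (nat (k - j))"
  shows "cocycle (wreath_cocycle \<theta>)"
proof -
  have "base_cocycle \<theta> (shift n y) (shift (n + m) z) = base_cocycle \<theta> y (shift m z)" for n m y z
    using base_cocycle_shift[of \<theta> t n y "shift m z"] assms by (simp add: shift_shift)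
  then show ?thesis
    by (simp add: cocycle_def wreath_cocycle_def norm_base_cocycle base_cocycle_add_left
        base_cocycle_add_right shift_add shift_shift zero_wreath_def plus_wreath_def)
qed

end

theory Submission
  imports Defs
begin

text \<open>
  Write \<open>A\<close> for the lamp group \<open>\<Oplus>\<^sub>\<int> \<int>\<close>, \<open>G\<close> for the wreath product, \<open>u\<^sub>g\<close> for the unitaries that
  generate the twisted group algebra of \<open>G\<close>, and \<open>\<tau>\<^sub>0\<close> for its canonical trace. Since \<open>A\<close> is abelian
  and \<open>\<sigma>\<^sub>\<theta>\<close> is a bicharacter, Kleppner's condition for \<open>A\<close> says that the commutator bicharacter
  \<open>\<sigma>\<^sub>\<theta>(x,y) / \<sigma>\<^sub>\<theta>(y,x)\<close> is nondegenerate.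

  Suppose that it is nondegenerate. Then the algebra of \<open>G\<close> has a Dixmier property: every \<open>T\<close> can be
  brought arbitrarily close to the scalar \<open>\<tau>\<^sub>0(T)\<close> by averaging its conjugates under the \<open>u\<^sub>y\<close> with
  \<open>y \<in> A\<close>. These averages commute with one another and are contractive, so only \<open>T = u\<^sub>g\<close> with
  \<open>g \<noteq> 0\<close> has to be treated. If \<open>g \<in> A\<close>, some \<open>u\<^sub>y\<close> commutes with \<open>u\<^sub>g\<close> up to a factor \<open>\<omega> \<noteq> 1\<close>, and
  averaging over the multiples of \<open>y\<close> gives the means of the powers of \<open>\<omega>\<close>, which tend to 0
  (\<open>averages_to_trace_commuting\<close>). If \<open>g \<notin> A\<close>, conjugation by \<open>A\<close> moves \<open>g\<close> to infinitely many
  elements; the mean \<open>T\<close> of \<open>N\<close> such conjugates has \<open>\<tau>\<^sub>0(T\<^sup>*T) = 1/N\<close>, and \<open>T\<^sup>*T\<close> lies in the span of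
  the \<open>u\<^sub>z\<close> with \<open>z \<in> A\<close>, for which the claim is known. The Schwarz inequality for averages turns a
  small average of \<open>T\<^sup>*T\<close> into a small average of \<open>T\<close> (\<open>averages_to_trace_infinite_orbit\<close>).

  A tracial state is constant on averages, and it is continuous; hence it equals \<open>\<tau>\<^sub>0\<close>. A nonzero closed
  ideal contains a nonzero \<open>T\<^sup>*T\<close>, therefore its averages, therefore the scalar \<open>\<tau>\<^sub>0(T\<^sup>*T) \<noteq> 0\<close>. This
  gives uniqueness of the trace and simplicity at the same time.

  Suppose now that the radical \<open>S\<close> of the commutator bicharacter is nontrivial. The function
  \<open>q(2x) = \<sigma>\<^sub>\<theta>(x,x)\<^sup>2\<close> trivializes the cocycle on the shift-invariant subgroup \<open>2S\<close>, and it is itself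
  shift-invariant. So \<open>u\<^sub>g \<mapsto> q(g)\<^sup>-\<^sup>1\<close> on \<open>2S\<close>, extended by 0, is formally a trace. It extends to the
  whole algebra as a limit of vector states, taken along Folner sets in \<open>2S\<close>, and it has absolute
  value 1 at \<open>u\<^sub>g\<close> for all \<open>g \<in> 2S\<close>, whereas \<open>\<tau>\<^sub>0(u\<^sub>g) = 0\<close> for \<open>g \<noteq> 0\<close>
  (\<open>not_unique_trace_if_not_kleppner\<close>).
\<close>

section \<open>The Hilbert space and its operators\<close>

lemma minus_ell2_apply: "ell2_apply (\<xi> - \<eta>) x = ell2_apply \<xi> x - ell2_apply \<eta> x"
  by (simp only: minus_ell2_def plus_ell2.rep_eq uminus_ell2.rep_eq) simp

lemma sum_square_ell2_apply_le:
  assumes "finite F"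
  shows "(\<Sum>x\<in>F. (cmod (ell2_apply \<xi> x))\<^sup>2) \<le> (norm \<xi>)\<^sup>2"
proof -
  have s: "(\<lambda>x. (cmod (ell2_apply \<xi> x))\<^sup>2) summable_on UNIV" using ell2_apply[of \<xi>] by simp
  show ?thesis
    unfolding norm_ell2_square by (rule finite_sum_le_infsum) (use s assms in auto)
qed

lemma cmod_ell2_apply_le: "cmod (ell2_apply \<xi> x) \<le> norm \<xi>"
  by (rule power2_le_imp_le) (use sum_square_ell2_apply_le[of "{x}" \<xi>] in simp_all)

text \<open>
  A Cauchy sequence converges in every coordinate. Passing to the limit in the Cauchy estimate over
  finitely many coordinates shows that the limit is square summable and is attained in norm.
\<close>

instance ell2 :: (type) banach
proof
  fix X :: "nat \<Rightarrow> 'a ell2"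
  assume C: "Cauchy X"
  have "Cauchy (\<lambda>n. ell2_apply (X n) x)" for x
  proof (rule metric_CauchyI)
    fix e :: real assume "e > 0"
    then obtain M where M: "\<And>m n. m \<ge> M \<Longrightarrow> n \<ge> M \<Longrightarrow> norm (X m - X n) < e"
      using C unfolding Cauchy_def dist_norm by blast
    show "\<exists>M. \<forall>m\<ge>M. \<forall>n\<ge>M. dist (ell2_apply (X m) x) (ell2_apply (X n) x) < e"
      unfolding dist_norm
      using M cmod_ell2_apply_le[of "X _ - X _" x] by (metis minus_ell2_apply le_less_trans)
  qed
  then obtain f where f: "\<And>x. (\<lambda>n. ell2_apply (X n) x) \<longlonglongrightarrow> f x"
    unfolding Cauchy_convergent_iff convergent_def by metis
  have tail: "(\<Sum>x\<in>F. (cmod (ell2_apply (X n) x - f x))\<^sup>2) \<le> e\<^sup>2"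
    if "finite F" "\<And>m. m \<ge> M \<Longrightarrow> norm (X n - X m) \<le> e" for F n M e
  proof (rule tendsto_upperbound)
    show "(\<lambda>m. \<Sum>x\<in>F. (cmod (ell2_apply (X n) x - ell2_apply (X m) x))\<^sup>2)
        \<longlonglongrightarrow> (\<Sum>x\<in>F. (cmod (ell2_apply (X n) x - f x))\<^sup>2)"
      by (intro tendsto_intros f)
    have "(\<Sum>x\<in>F. (cmod (ell2_apply (X n) x - ell2_apply (X m) x))\<^sup>2) \<le> e\<^sup>2" if "m \<ge> M" for m
      using sum_square_ell2_apply_le[OF \<open>finite F\<close>, of "X n - X m"] \<open>m \<ge> M \<Longrightarrow> norm (X n - X m) \<le> e\<close> that
      by (simp add: minus_ell2_apply) (meson norm_ge_zero order_trans power_mono)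
    then show "\<forall>\<^sub>F m in sequentially.
        (\<Sum>x\<in>F. (cmod (ell2_apply (X n) x - ell2_apply (X m) x))\<^sup>2) \<le> e\<^sup>2"
      by (auto simp: eventually_sequentially)
  qed auto
  have summ: "(\<lambda>x. (cmod (ell2_apply (X n) x - f x))\<^sup>2) summable_on UNIV"
    if "\<And>m. m \<ge> M \<Longrightarrow> norm (X n - X m) \<le> e" for n M e
    by (rule nonneg_bdd_above_summable_on) (use tail[OF _ that] in \<open>auto intro!: bdd_aboveI\<close>)
  obtain M where M: "\<And>m. m \<ge> M \<Longrightarrow> norm (X M - X m) \<le> 1"
    using C unfolding Cauchy_def dist_norm by (metis less_imp_le order_refl zero_less_one)
  have "(\<lambda>x. (cmod (ell2_apply (X M) x + (-1) * (ell2_apply (X M) x - f x)))\<^sup>2) summable_on UNIV"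
    using ell2_apply[of "X M"]
    by (intro square_summable_add square_summable_cmult summ[of M M 1, OF M]) auto
  then have fs: "(\<lambda>x. (cmod (f x))\<^sup>2) summable_on UNIV" by simp
  define L where "L = Abs_ell2 f"
  have L: "ell2_apply L x = f x" for x
    unfolding L_def using fs by (subst Abs_ell2_inverse) auto
  have "X \<longlonglongrightarrow> L"
  proof (rule LIMSEQ_I)
    fix r :: real assume "r > 0"
    then obtain M where M: "\<And>m n. m \<ge> M \<Longrightarrow> n \<ge> M \<Longrightarrow> norm (X n - X m) < r / 2"
      using C unfolding Cauchy_def dist_norm by (metis half_gt_zero)
    have "norm (X n - L) < r" if "n \<ge> M" for n
    proof -
      have b: "norm (X n - X m) \<le> r / 2" if "m \<ge> M" for m
        using M[OF that \<open>n \<ge> M\<close>] by simp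
      have "(norm (X n - L))\<^sup>2 \<le> (r / 2)\<^sup>2"
        unfolding norm_ell2_square minus_ell2_apply L
        by (rule infsum_le_finite_sums) (use summ[OF b] tail[OF _ b] in auto)
      then have "norm (X n - L) \<le> r / 2" by (rule power2_le_imp_le) (use \<open>r > 0\<close> in simp)
      then show ?thesis using \<open>r > 0\<close> by simp
    qed
    then show "\<exists>M. \<forall>n\<ge>M. norm (X n - L) < r" by blast
  qed
  then show "convergent X" by (auto simp: convergent_def)
qed

lemma ell2_cinner_add_right: "ell2_cinner \<xi> (\<eta> + \<zeta>) = ell2_cinner \<xi> \<eta> + ell2_cinner \<xi> \<zeta>"
  by (metis ell2_cinner_add_left ell2_cinner_cnj complex_cnj_add)

lemma ell2_cinner_scale_right: "ell2_cinner \<xi> (ell2_scale c \<eta>) = cnj c * ell2_cinner \<xi> \<eta>"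
  by (metis ell2_cinner_scale_left ell2_cinner_cnj complex_cnj_mult)

lemma ell2_cinner_self_norm: "ell2_cinner \<xi> \<xi> = complex_of_real ((norm \<xi>)\<^sup>2)"
  by (simp add: ell2_cinner_self norm_ell2_square)

lemma exists_unit_rotation: "\<exists>c. cmod c = 1 \<and> c * z = complex_of_real (cmod z)"
proof (cases "z = 0")
  case False
  then have "cmod (cnj z / cmod z) = 1" "cnj z / cmod z * z = cmod z"
    using complex_norm_square[of z]
    by (simp_all add: norm_divide mult.commute power2_eq_square field_simps)
  then show ?thesis by blast
qed (auto intro: exI[of _ 1])

lemma cmod_ell2_cinner_le: "cmod (ell2_cinner \<xi> \<eta>) \<le> norm \<xi> * norm \<eta>"
proof -
  obtain c where c: "cmod c = 1" "c * ell2_cinner \<xi> \<eta> = complex_of_real (cmod (ell2_cinner \<xi> \<eta>))"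
    using exists_unit_rotation by blast
  have "cmod (ell2_cinner \<xi> \<eta>) = inner (ell2_scale c \<xi>) \<eta>"
    by (simp add: inner_ell2_def ell2_cinner_scale_left c)
  also have "\<dots> \<le> norm (ell2_scale c \<xi>) * norm \<eta>" by (rule norm_cauchy_schwarz)
  finally show ?thesis by (simp add: norm_ell2_scale c)
qed

lemma bounded_bilinear_ell2_cinner: "bounded_bilinear ell2_cinner"
proof
  show "\<exists>K. \<forall>a b. norm (ell2_cinner a b) \<le> norm a * norm b * K"
    by (rule exI[of _ 1]) (simp add: cmod_ell2_cinner_le)
qed (simp_all add: ell2_cinner_add_left ell2_cinner_add_right scaleR_ell2_def
    ell2_cinner_scale_left ell2_cinner_scale_right scaleR_conv_of_real)

lemma ell2_eq_by_cinner:
  assumes "\<And>\<zeta>. ell2_cinner \<zeta> \<xi> = ell2_cinner \<zeta> \<eta>"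
  shows "\<xi> = \<eta>"
proof -
  interpret bounded_bilinear ell2_cinner by (rule bounded_bilinear_ell2_cinner)
  have "ell2_cinner (\<xi> - \<eta>) (\<xi> - \<eta>) = 0" by (simp add: diff_right assms)
  then show ?thesis unfolding ell2_cinner_self_norm of_real_eq_0_iff by simp
qed

lift_definition ell2_delta :: "'a \<Rightarrow> 'a ell2" is "\<lambda>a x. if x = a then 1 else 0"
proof -
  fix a :: 'a
  have "(\<lambda>x. (cmod (if x = a then 1 else 0))\<^sup>2) summable_on UNIV \<longleftrightarrow>
      (\<lambda>x. (cmod (if x = a then 1 else 0))\<^sup>2) summable_on {a}"
    by (rule summable_on_cong_neutral) auto
  then show "(\<lambda>x. (cmod (if x = a then 1 else 0))\<^sup>2) summable_on UNIV" by simp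
qed

lemma ell2_cinner_delta: "ell2_cinner \<xi> (ell2_delta a) = ell2_apply \<xi> a"
proof -
  have "ell2_cinner \<xi> (ell2_delta a) = (\<Sum>\<^sub>\<infinity>x\<in>{a}. ell2_apply \<xi> x * cnj (if x = a then 1 else 0))"
    unfolding ell2_cinner.rep_eq ell2_delta.rep_eq by (rule infsum_cong_neutral) auto
  then show ?thesis by simp
qed

lemma norm_ell2_delta: "norm (ell2_delta a) = 1"
proof -
  have "complex_of_real ((norm (ell2_delta a))\<^sup>2) = 1"
    unfolding ell2_cinner_self_norm[symmetric] ell2_cinner_delta by (simp add: ell2_delta.rep_eq)
  then have "(norm (ell2_delta a))\<^sup>2 = 1" by (simp only: of_real_eq_1_iff)
  then show ?thesis using norm_ge_zero[of "ell2_delta a"] by (simp add: power2_eq_1_iff)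
qed

lemma op_scale_apply: "blinfun_apply (op_scale c T) \<xi> = ell2_scale c (T \<xi>)"
  by (simp add: op_scale_def scalar_op.rep_eq)

lemma ell2_scale_simps:
  "ell2_scale 1 \<xi> = \<xi>" "ell2_scale c (ell2_scale d \<xi>) = ell2_scale (c * d) \<xi>"
  "ell2_scale c 0 = 0" "ell2_scale (-1) \<xi> = - \<xi>"
  "ell2_scale c (\<xi> + \<eta>) = ell2_scale c \<xi> + ell2_scale c \<eta>"
  "ell2_scale (c + d) \<xi> = ell2_scale c \<xi> + ell2_scale d \<xi>"
  "ell2_scale c (r *\<^sub>R \<xi>) = r *\<^sub>R ell2_scale c \<xi>"
  by (auto intro!: ell2_eqI simp: ell2_scale.rep_eq zero_ell2.rep_eq plus_ell2.rep_eq
      uminus_ell2.rep_eq scaleR_ell2_def algebra_simps)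

lemma op_scale_simps:
  "op_scale 1 T = T" "op_scale c (op_scale d T) = op_scale (c * d) T"
  "op_scale c 0 = 0" "op_scale (-1) T = - T"
  "op_scale c (S + T) = op_scale c S + op_scale c T"
  "op_scale (c + d) T = op_scale c T + op_scale d T"
  "op_scale c (r *\<^sub>R T) = r *\<^sub>R op_scale c T"
  "op_scale c S o\<^sub>L T = op_scale c (S o\<^sub>L T)"
  by (rule blinfun_eqI, simp add: op_scale_apply ell2_scale_simps blinfun.bilinear_simps)+

lemma op_scale_zero: "op_scale 0 T = 0"
  by (intro blinfun_eqI ell2_eqI) (simp add: op_scale_apply ell2_scale.rep_eq zero_ell2.rep_eq)

lemma op_scale_of_real: "op_scale (complex_of_real r) T = r *\<^sub>R T"
  by (rule blinfun_eqI) (simp add: op_scale_apply scaleR_ell2_def blinfun.bilinear_simps)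

lemma comp_op_scale: "S \<in> bounded_ops \<Longrightarrow> S o\<^sub>L op_scale c T = op_scale c (S o\<^sub>L T)"
  by (rule blinfun_eqI) (simp add: op_scale_apply bounded_ops_def)

lemma norm_op_scale: "norm (op_scale c T) = cmod c * norm T"
proof (rule antisym)
  show le: "norm (op_scale c T) \<le> cmod c * norm T" for c and T :: "'a ell2_op"
  proof (rule norm_blinfun_bound)
    show "norm (op_scale c T \<xi>) \<le> cmod c * norm T * norm \<xi>" for \<xi>
      using norm_blinfun[of T \<xi>]
      by (simp add: op_scale_apply norm_ell2_scale mult.assoc mult_left_mono)
  qed simp
  show "cmod c * norm T \<le> norm (op_scale c T)"
  proof (cases "c = 0")
    case False
    have "norm T \<le> cmod (1 / c) * norm (op_scale c T)"
      using le[of "1 / c" "op_scale c T"] False by (simp add: op_scale_simps)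
    then show ?thesis using False by (simp add: norm_divide field_simps)
  qed simp
qed

lemma bounded_linear_op_scale: "bounded_linear (op_scale c)"
  by (rule bounded_linear_intro[where K = "cmod c"])
    (simp_all add: op_scale_simps norm_op_scale mult.commute)

lemmas tendsto_op_scale [tendsto_intros] = bounded_linear.tendsto[OF bounded_linear_op_scale]

lemma op_scale_diff: "op_scale c (S - T) = op_scale c S - op_scale c T"
  by (rule linear_diff[OF bounded_linear.linear[OF bounded_linear_op_scale]])

lemmas tendsto_compose_blinfun [tendsto_intros] =
  bounded_bilinear.tendsto[OF bounded_bilinear_blinfun_compose]

lemmas tendsto_ell2_cinner [tendsto_intros] =
  bounded_bilinear.tendsto[OF bounded_bilinear_ell2_cinner]

lemma subspaceD:
  assumes "complex_subspace V"
  shows "0 \<in> V" "S \<in> V \<Longrightarrow> T \<in> V \<Longrightarrow> S + T \<in> V" "T \<in> V \<Longrightarrow> op_scale c T \<in> V"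
    "T \<in> V \<Longrightarrow> r *\<^sub>R T \<in> V" "T \<in> V \<Longrightarrow> - T \<in> V" "S \<in> V \<Longrightarrow> T \<in> V \<Longrightarrow> S - T \<in> V"
proof -
  show 1: "0 \<in> V" "\<And>S T. S \<in> V \<Longrightarrow> T \<in> V \<Longrightarrow> S + T \<in> V" "\<And>c T. T \<in> V \<Longrightarrow> op_scale c T \<in> V"
    using assms by (auto simp: complex_subspace_def)
  show "T \<in> V \<Longrightarrow> r *\<^sub>R T \<in> V" using 1(3)[of T "of_real r"] by (simp add: op_scale_of_real)
  show 2: "T \<in> V \<Longrightarrow> - T \<in> V" for T using 1(3)[of T "-1"] by (simp add: op_scale_simps)
  show "S \<in> V \<Longrightarrow> T \<in> V \<Longrightarrow> S - T \<in> V"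
    using 1(2)[OF _ 2, of S T] by simp
qed

lemma blinfun_compose_assoc: "(R o\<^sub>L S) o\<^sub>L T = R o\<^sub>L (S o\<^sub>L T)"
  by (rule blinfun_eqI) simp

lemma blinfun_compose_id: "T o\<^sub>L id_blinfun = T" "id_blinfun o\<^sub>L T = T"
  by (rule blinfun_eqI, simp)+

lemma closed_preimage_in:
  fixes V :: "'a ell2_op set"
  assumes "closed V" "\<And>X T. X \<longlonglongrightarrow> T \<Longrightarrow> (\<lambda>n. f (X n)) \<longlonglongrightarrow> f T"
  shows "closed {T \<in> V. f T \<in> V}"
  unfolding closed_sequential_limits
proof (intro allI impI, elim conjE)
  fix X T assume X: "\<forall>n. X n \<in> {T \<in> V. f T \<in> V}" "X \<longlonglongrightarrow> T"
  have "T \<in> V" using closed_sequentially[OF assms(1) _ X(2)] X(1) by simp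
  moreover have "f T \<in> V" using closed_sequentially[OF assms(1) _ assms(2)[OF X(2)]] X(1) by simp
  ultimately show "T \<in> {T \<in> V. f T \<in> V}" by simp
qed

subsection \<open>Adjoints\<close>

lemma adjoint_of_sym: "adjoint_of T S \<Longrightarrow> adjoint_of S T"
  unfolding adjoint_of_def by (metis ell2_cinner_cnj)

lemma adjoint_of_unique: "adjoint_of T S \<Longrightarrow> adjoint_of T S' \<Longrightarrow> S = S'"
  unfolding adjoint_of_def by (intro blinfun_eqI ell2_eq_by_cinner) metis

lemma adjoint_of_norm_le:
  assumes "adjoint_of T S" shows "norm S \<le> norm T"
proof (rule norm_blinfun_bound)
  fix \<eta>
  have "ell2_cinner (S \<eta>) (S \<eta>) = ell2_cinner (T (S \<eta>)) \<eta>"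
    using assms by (simp add: adjoint_of_def)
  then have "(norm (S \<eta>))\<^sup>2 = cmod (ell2_cinner (T (S \<eta>)) \<eta>)"
    unfolding ell2_cinner_self_norm by (metis abs_of_nonneg norm_of_real zero_le_power2)
  also have "\<dots> \<le> norm (T (S \<eta>)) * norm \<eta>" by (rule cmod_ell2_cinner_le)
  also have "\<dots> \<le> norm T * norm (S \<eta>) * norm \<eta>"
    by (intro mult_right_mono norm_blinfun) auto
  finally have "norm (S \<eta>) * norm (S \<eta>) \<le> (norm T * norm \<eta>) * norm (S \<eta>)"
    by (simp add: power2_eq_square mult_ac)
  then show "norm (S \<eta>) \<le> norm T * norm \<eta>"
    by (cases "norm (S \<eta>) = 0") (auto simp: mult_le_cancel_right)
qed simp

lemma adjoint_of_norm_eq: "adjoint_of T S \<Longrightarrow> norm S = norm T"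
  by (meson adjoint_of_norm_le adjoint_of_sym antisym)

lemma adjoint_of_add: "adjoint_of T S \<Longrightarrow> adjoint_of T' S' \<Longrightarrow> adjoint_of (T + T') (S + S')"
  by (simp add: adjoint_of_def blinfun.bilinear_simps ell2_cinner_add_left ell2_cinner_add_right)

lemma adjoint_of_op_scale: "adjoint_of T S \<Longrightarrow> adjoint_of (op_scale c T) (op_scale (cnj c) S)"
  by (simp add: adjoint_of_def op_scale_apply ell2_cinner_scale_left ell2_cinner_scale_right)

lemma adjoint_of_scaleR: "adjoint_of T S \<Longrightarrow> adjoint_of (r *\<^sub>R T) (r *\<^sub>R S)"
  using adjoint_of_op_scale[of T S "of_real r"] by (simp add: op_scale_of_real)

lemma adjoint_of_diff: "adjoint_of T S \<Longrightarrow> adjoint_of T' S' \<Longrightarrow> adjoint_of (T - T') (S - S')"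
  using adjoint_of_add[of T S "- T'" "- S'"] adjoint_of_scaleR[of T' S' "-1"] by simp

lemma adjoint_of_compose: "adjoint_of T S \<Longrightarrow> adjoint_of T' S' \<Longrightarrow> adjoint_of (T o\<^sub>L T') (S' o\<^sub>L S)"
  by (simp add: adjoint_of_def)

lemma adjoint_of_0: "adjoint_of 0 0"
  using adjoint_of_scaleR[of id_blinfun id_blinfun 0] by (simp add: adjoint_of_def)

lemma adjoint_of_id: "adjoint_of id_blinfun id_blinfun"
  by (simp add: adjoint_of_def)

lemma adjoint_of_limit:
  assumes "\<And>n. adjoint_of (X n) (Y n)" "X \<longlonglongrightarrow> T" "Y \<longlonglongrightarrow> S"
  shows "adjoint_of T S"
  unfolding adjoint_of_def
proof (intro allI)
  fix \<xi> \<eta>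
  have "(\<lambda>n. ell2_cinner (X n \<xi>) \<eta>) \<longlonglongrightarrow> ell2_cinner (T \<xi>) \<eta>"
    "(\<lambda>n. ell2_cinner \<xi> (Y n \<eta>)) \<longlonglongrightarrow> ell2_cinner \<xi> (S \<eta>)"
    by (intro tendsto_intros assms)+
  moreover have "(\<lambda>n. ell2_cinner (X n \<xi>) \<eta>) = (\<lambda>n. ell2_cinner \<xi> (Y n \<eta>))"
    using assms(1) by (simp add: adjoint_of_def)
  ultimately show "ell2_cinner (T \<xi>) \<eta> = ell2_cinner \<xi> (S \<eta>)" using LIMSEQ_unique by metis
qed

section \<open>The reduced twisted group algebra\<close>

locale twisted_group =
  fixes \<sigma> :: "'g::group_add \<Rightarrow> 'g \<Rightarrow> complex"
  assumes cocycle: "cocycle \<sigma>"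
begin

abbreviation u :: "'g \<Rightarrow> 'g ell2_op" where "u \<equiv> twisted_reg \<sigma>"
abbreviation AR :: "'g ell2_op set" where "AR \<equiv> reduced_cstar \<sigma>"

text \<open>The inverse, and the adjoint, of the unitary \<open>u g\<close>.\<close>

definition u_inv :: "'g \<Rightarrow> 'g ell2_op" where
  "u_inv g = op_scale (inverse (\<sigma> g (- g))) (u (- g))"

lemma cmod_cocycle [simp]: "cmod (\<sigma> g h) = 1"
  and cocycle_0 [simp]: "\<sigma> g 0 = 1" "\<sigma> 0 g = 1"
  and cocycle_assoc: "\<sigma> g h * \<sigma> (g + h) k = \<sigma> h k * \<sigma> g (h + k)"
  using cocycle by (auto simp: cocycle_def)

lemma cocycle_nz [simp]: "\<sigma> g h \<noteq> 0"
  using cmod_cocycle[of g h] by (metis norm_zero zero_neq_one)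

lemma cnj_cocycle: "cnj (\<sigma> g h) = inverse (\<sigma> g h)"
  using complex_norm_square[of "\<sigma> g h"] by (simp add: field_simps)

lemma cocycle_inverse_commute: "\<sigma> (- g) g = \<sigma> g (- g)"
  using cocycle_assoc[of g "- g" g] by simp

lemmas u_apply = ell2_apply_twisted_reg[OF cocycle]

lemma u_0: "u 0 = id_blinfun"
  by (intro blinfun_eqI ell2_eqI) (simp add: u_apply)

lemma u_compose: "u g o\<^sub>L u h = op_scale (\<sigma> g h) (u (g + h))"
proof (intro blinfun_eqI ell2_eqI)
  fix \<xi> x
  have "h + (- h - g) = - g" by (simp only: diff_conv_add_uminus add_minus_cancel)
  then show "ell2_apply ((u g o\<^sub>L u h) \<xi>) x = ell2_apply (op_scale (\<sigma> g h) (u (g + h)) \<xi>) x"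
    using cocycle_assoc[of g h "- h + (- g + x)"]
    by (simp add: u_apply op_scale_apply ell2_scale.rep_eq minus_add add.assoc[symmetric])
qed

lemma u_bounded_ops: "u g \<in> bounded_ops" by (rule twisted_reg_bounded_ops[OF cocycle])

lemma u_u_inv: "u g o\<^sub>L u_inv g = id_blinfun" and u_inv_u: "u_inv g o\<^sub>L u g = id_blinfun"
  by (simp_all add: u_inv_def comp_op_scale[OF u_bounded_ops] op_scale_simps u_compose u_0
      cocycle_inverse_commute)

lemma u_isometry: "ell2_cinner (u g \<xi>) (u g \<eta>) = ell2_cinner \<xi> \<eta>"
proof -
  have c: "\<sigma> g x * cnj (\<sigma> g x) = 1" for x
    by (simp add: cnj_cocycle)
  have "ell2_cinner (u g \<xi>) (u g \<eta>) =
      (\<Sum>\<^sub>\<infinity>x. ell2_apply \<xi> (- g + x) * cnj (ell2_apply \<eta> (- g + x)))"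
    unfolding ell2_cinner.rep_eq u_apply
    by (rule infsum_cong) (simp add: mult_ac c)
  also have "\<dots> = ell2_cinner \<xi> \<eta>"
    unfolding ell2_cinner.rep_eq
    by (rule infsum_reindex_bij_betw[OF bij_left_translation[OF cocycle],
          of "\<lambda>x. ell2_apply \<xi> x * cnj (ell2_apply \<eta> x)"])
  finally show ?thesis .
qed

lemma adjoint_of_u: "adjoint_of (u g) (u_inv g)"
  unfolding adjoint_of_def
proof (intro allI)
  fix \<xi> \<eta>
  have "u g (u_inv g \<eta>) = \<eta>"
    using arg_cong[OF u_u_inv[of g], of "\<lambda>T. blinfun_apply T \<eta>"] by simp
  then show "ell2_cinner (u g \<xi>) \<eta> = ell2_cinner \<xi> (u_inv g \<eta>)"
    using u_isometry[of g \<xi> "u_inv g \<eta>"] by simp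
qed

lemma norm_u_apply: "norm (u g \<xi>) = norm \<xi>"
proof -
  have "complex_of_real ((norm (u g \<xi>))\<^sup>2) = of_real ((norm \<xi>)\<^sup>2)"
    using u_isometry[of g \<xi> \<xi>] unfolding ell2_cinner_self_norm .
  then have "(norm (u g \<xi>))\<^sup>2 = (norm \<xi>)\<^sup>2" by (simp only: of_real_eq_iff)
  then show ?thesis by (simp add: power2_eq_iff_nonneg)
qed

lemma norm_u_le: "norm (u g) \<le> 1"
  by (rule norm_blinfun_bound) (simp_all add: norm_u_apply)

lemma norm_u_inv_le: "norm (u_inv g) \<le> 1"
  using adjoint_of_norm_eq[OF adjoint_of_u] norm_u_le by simp

lemma norm_u_compose_le: "norm (u g o\<^sub>L T o\<^sub>L u_inv g) \<le> norm T"
proof -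
  have "norm (u g o\<^sub>L T o\<^sub>L u_inv g) \<le> norm (u g) * norm T * norm (u_inv g)"
    by (meson norm_blinfun_compose order_trans mult_right_mono norm_ge_zero)
  also have "\<dots> \<le> 1 * norm T * 1"
    by (intro mult_mono norm_u_le norm_u_inv_le) auto
  finally show ?thesis by simp
qed

lemma u_delta: "u g (ell2_delta h) = ell2_scale (\<sigma> g h) (ell2_delta (g + h))"
proof (rule ell2_eqI)
  fix x
  have "- g + x = h \<longleftrightarrow> x = g + h" by (metis add.assoc add.left_inverse add.right_inverse add_0)
  then show "ell2_apply (u g (ell2_delta h)) x =
      ell2_apply (ell2_scale (\<sigma> g h) (ell2_delta (g + h))) x"
    by (auto simp: u_apply ell2_delta.rep_eq ell2_scale.rep_eq)
qed

subsection \<open>Approximation by finite combinations of the unitaries\<close>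

text \<open>
  Being a hull, the closed linear span comes with an induction principle: a closed subspace that
  contains all \<open>u g\<close> contains the span.
\<close>

definition u_span :: "'g ell2_op set" where
  "u_span = (\<lambda>V. complex_subspace V \<and> closed V) hull (range u)"

lemma complex_subspace_u_span: "complex_subspace u_span" and closed_u_span: "closed u_span"
proof -
  have "complex_subspace u_span \<and> closed u_span"
    unfolding u_span_def
    by (rule hull_in) (auto simp: complex_subspace_def intro: closed_Inter)
  then show "complex_subspace u_span" "closed u_span" by auto
qed

lemma u_in_u_span: "u g \<in> u_span"
  unfolding u_span_def by (rule hull_inc) simp

lemma u_span_subset:
  assumes "complex_subspace V" "closed V" "\<And>g. u g \<in> V"
  shows "u_span \<subseteq> V"
  unfolding u_span_def by (rule hull_minimal) (use assms in auto)

lemma closed_bounded_ops: "closed (bounded_ops :: 'a ell2_op set)"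
proof (rule closed_sequential_limits[THEN iffD2], safe)
  fix X and T :: "'a ell2_op"
  assume X: "\<forall>n. X n \<in> bounded_ops" "X \<longlonglongrightarrow> T"
  show "T \<in> bounded_ops"
    unfolding bounded_ops_def
  proof (intro CollectI allI)
    fix c \<xi>
    have "(\<lambda>n. op_scale c (X n) \<xi>) \<longlonglongrightarrow> op_scale c T \<xi>" "(\<lambda>n. X n (ell2_scale c \<xi>)) \<longlonglongrightarrow> T (ell2_scale c \<xi>)"
      by (intro tendsto_intros X)+
    then show "T (ell2_scale c \<xi>) = ell2_scale c (T \<xi>)"
      using X(1) LIMSEQ_unique by (simp add: bounded_ops_def op_scale_apply)
  qed
qed

lemma complex_subspace_bounded_ops: "complex_subspace (bounded_ops :: 'a ell2_op set)"
  by (auto simp: complex_subspace_def bounded_ops_def op_scale_apply ell2_scale_simps mult.commute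
      blinfun.bilinear_simps)

lemma u_span_bounded_ops: "u_span \<subseteq> bounded_ops"
  by (rule u_span_subset[OF complex_subspace_bounded_ops closed_bounded_ops u_bounded_ops])

lemma u_span_compose:
  assumes "S \<in> u_span" "T \<in> u_span" shows "S o\<^sub>L T \<in> u_span"
proof -
  note V = subspaceD[OF complex_subspace_u_span] closed_u_span
  have 1: "u g o\<^sub>L T \<in> u_span" if "T \<in> u_span" for g T
  proof -
    have "u_span \<subseteq> {T \<in> u_span. u g o\<^sub>L T \<in> u_span}"
    proof (rule u_span_subset)
      show "complex_subspace {T \<in> u_span. u g o\<^sub>L T \<in> u_span}"
        by (auto simp: complex_subspace_def comp_op_scale u_bounded_ops
            bounded_bilinear.add_right[OF bounded_bilinear_blinfun_compose] intro: V)
      show "closed {T \<in> u_span. u g o\<^sub>L T \<in> u_span}"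
        by (intro closed_preimage_in closed_u_span tendsto_intros)
      show "u h \<in> {T \<in> u_span. u g o\<^sub>L T \<in> u_span}" for h
        by (simp add: u_compose u_in_u_span V)
    qed
    then show ?thesis using that by auto
  qed
  have "u_span \<subseteq> {S \<in> u_span. S o\<^sub>L T \<in> u_span}"
  proof (rule u_span_subset)
    show "complex_subspace {S \<in> u_span. S o\<^sub>L T \<in> u_span}"
      by (auto simp: complex_subspace_def op_scale_simps
            bounded_bilinear.add_left[OF bounded_bilinear_blinfun_compose] intro: V)
    show "closed {S \<in> u_span. S o\<^sub>L T \<in> u_span}"
      by (intro closed_preimage_in closed_u_span tendsto_intros)
    show "u h \<in> {S \<in> u_span. S o\<^sub>L T \<in> u_span}" for h
      by (simp add: 1 u_in_u_span assms)
  qed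
  then show ?thesis using assms by auto
qed

text \<open>Adjunction is isometric, so the adjoints of a convergent sequence converge by completeness.\<close>

lemma u_span_adjoint_exists:
  assumes "T \<in> u_span" shows "\<exists>S\<in>u_span. adjoint_of T S"
proof -
  note V = subspaceD[OF complex_subspace_u_span] closed_u_span
  have "u_span \<subseteq> {T. \<exists>S\<in>u_span. adjoint_of T S}"
  proof (rule u_span_subset)
    show "complex_subspace {T. \<exists>S\<in>u_span. adjoint_of T S}"
      unfolding complex_subspace_def
      by (blast intro: adjoint_of_0 adjoint_of_add adjoint_of_op_scale V)
    show "u g \<in> {T. \<exists>S\<in>u_span. adjoint_of T S}" for g
      using adjoint_of_u[of g] by (auto simp: u_inv_def intro: V u_in_u_span)
    show "closed {T. \<exists>S\<in>u_span. adjoint_of T S}"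
      unfolding closed_sequential_limits
    proof (safe)
      fix X T assume X: "\<forall>n. X n \<in> {T. \<exists>S\<in>u_span. adjoint_of T S}" "X \<longlonglongrightarrow> T"
      then obtain Y where Y: "\<And>n. Y n \<in> u_span" "\<And>n. adjoint_of (X n) (Y n)" by auto metis
      have "norm (Y m - Y n) = norm (X m - X n)" for m n
        by (intro adjoint_of_norm_eq adjoint_of_diff Y)
      moreover have "Cauchy X" using X(2) by (metis convergent_Cauchy convergentI)
      ultimately have "Cauchy Y" unfolding Cauchy_def dist_norm by simp
      then obtain S where S: "Y \<longlonglongrightarrow> S" by (metis Cauchy_convergent convergentD)
      moreover have "S \<in> u_span" using closed_u_span S Y(1) unfolding closed_sequential_limits by blast
      ultimately show "\<exists>S\<in>u_span. adjoint_of T S"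
        using adjoint_of_limit[OF Y(2) X(2) S] by blast
    qed
  qed
  then show ?thesis using assms by auto
qed

text \<open>
  Products and adjoints of the \<open>u g\<close> are scalar multiples of unitaries of the same form, so the
  closed span is already an algebra. Linear and continuous statements about the reduced algebra may
  thus be checked on the \<open>u g\<close>.
\<close>

lemma reduced_cstar_eq_u_span: "AR = u_span"
proof (rule antisym)
  have "cstar_subalgebra u_span"
    unfolding cstar_subalgebra_def
    using u_span_bounded_ops complex_subspace_u_span closed_u_span u_span_compose
      u_span_adjoint_exists adjoint_of_unique by (metis (no_types, lifting))
  then show "AR \<subseteq> u_span"
    unfolding reduced_cstar_def by (intro hull_minimal) (auto intro: u_in_u_span)
  show "u_span \<subseteq> AR"
    unfolding reduced_cstar_def u_span_def hull_def cstar_subalgebra_def by auto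
qed

lemmas AR_subspace = subspaceD[OF complex_subspace_u_span, folded reduced_cstar_eq_u_span]
lemmas AR_closed = closed_u_span[folded reduced_cstar_eq_u_span]
lemmas u_in_AR = u_in_u_span[folded reduced_cstar_eq_u_span]
lemmas AR_compose = u_span_compose[folded reduced_cstar_eq_u_span]
lemmas AR_adjoint_exists = u_span_adjoint_exists[folded reduced_cstar_eq_u_span]
lemmas AR_subset = u_span_subset[folded reduced_cstar_eq_u_span]
lemmas AR_bounded_ops = u_span_bounded_ops[folded reduced_cstar_eq_u_span]

lemma AR_limit: "(\<And>n. X n \<in> AR) \<Longrightarrow> X \<longlonglongrightarrow> T \<Longrightarrow> T \<in> AR"
  using AR_closed unfolding closed_sequential_limits by blast

lemma AR_adjoint: "T \<in> AR \<Longrightarrow> adjoint_of T S \<Longrightarrow> S \<in> AR"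
  using AR_adjoint_exists adjoint_of_unique by metis

lemma id_in_AR: "id_blinfun \<in> AR" using u_in_AR[of 0] by (simp add: u_0)

lemma u_inv_in_AR: "u_inv g \<in> AR" by (simp add: u_inv_def AR_subspace u_in_AR)

lemmas AR_comp_op_scale = comp_op_scale[OF subsetD[OF AR_bounded_ops]]

subsection \<open>Traces as limits of vector states\<close>

text \<open>
  The trace property is linear and continuous in each variable separately: it extends from the
  generators in one variable first and then in the other.
\<close>

lemma trace_from_generators:
  assumes add: "\<And>S T. S \<in> AR \<Longrightarrow> T \<in> AR \<Longrightarrow> \<tau> (S + T) = \<tau> S + (\<tau> T :: complex)"
    and scale: "\<And>c T. T \<in> AR \<Longrightarrow> \<tau> (op_scale c T) = c * \<tau> T"
    and lim: "\<And>X T. (\<And>n. X n \<in> AR) \<Longrightarrow> X \<longlonglongrightarrow> T \<Longrightarrow> (\<lambda>n. \<tau> (X n)) \<longlonglongrightarrow> \<tau> T"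
    and gen: "\<And>g h. \<sigma> g h * \<tau> (u (g + h)) = \<sigma> h g * \<tau> (u (h + g))"
    and S: "S \<in> AR" and T: "T \<in> AR"
  shows "\<tau> (S o\<^sub>L T) = \<tau> (T o\<^sub>L S)"
proof -
  have zero: "\<tau> 0 = 0" using scale[OF id_in_AR, of 0] by (simp add: op_scale_zero)
  have step: "AR \<subseteq> {S \<in> AR. \<tau> (S o\<^sub>L T) = \<tau> (T o\<^sub>L S)}"
    if T: "T \<in> AR" and G: "\<And>g. \<tau> (u g o\<^sub>L T) = \<tau> (T o\<^sub>L u g)" for T
  proof (rule AR_subset)
    show "complex_subspace {S \<in> AR. \<tau> (S o\<^sub>L T) = \<tau> (T o\<^sub>L S)}"
      by (auto simp: complex_subspace_def AR_comp_op_scale op_scale_simps T add scale AR_compose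
            bounded_bilinear.add_left[OF bounded_bilinear_blinfun_compose]
            bounded_bilinear.add_right[OF bounded_bilinear_blinfun_compose] intro: AR_subspace)
    show "closed {S \<in> AR. \<tau> (S o\<^sub>L T) = \<tau> (T o\<^sub>L S)}"
      unfolding closed_sequential_limits
    proof (intro allI impI, elim conjE)
      fix X S assume X: "\<forall>n. X n \<in> {S \<in> AR. \<tau> (S o\<^sub>L T) = \<tau> (T o\<^sub>L S)}" "X \<longlonglongrightarrow> S"
      have "(\<lambda>n. \<tau> (X n o\<^sub>L T)) \<longlonglongrightarrow> \<tau> (S o\<^sub>L T)" "(\<lambda>n. \<tau> (T o\<^sub>L X n)) \<longlonglongrightarrow> \<tau> (T o\<^sub>L S)"
        using X(1) by (intro lim tendsto_intros X(2) AR_compose T; simp)+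
      moreover have "S \<in> AR" using X AR_limit by blast
      ultimately show "S \<in> {S \<in> AR. \<tau> (S o\<^sub>L T) = \<tau> (T o\<^sub>L S)}"
        using X(1) LIMSEQ_unique by auto
    qed
    show "u g \<in> {S \<in> AR. \<tau> (S o\<^sub>L T) = \<tau> (T o\<^sub>L S)}" for g
      using G by (simp add: u_in_AR)
  qed
  have "\<tau> (u g o\<^sub>L u h) = \<tau> (u h o\<^sub>L u g)" for g h
    by (simp add: u_compose scale u_in_AR gen)
  then have "\<tau> (T o\<^sub>L u h) = \<tau> (u h o\<^sub>L T)" for h
    using step[OF u_in_AR] T by auto
  then show ?thesis using step[OF T] S by auto
qed

text \<open>
  Vector states are bounded by the norm, so convergence on the unitaries suffices for convergence
  on the whole algebra.
\<close>

lemma tracial_state_limit_of_vector_states: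
  assumes unit: "\<And>n::nat. norm (\<xi> n) = 1"
    and lim: "\<And>g. (\<lambda>n. ell2_cinner (u g (\<xi> n)) (\<xi> n)) \<longlonglongrightarrow> \<phi> g"
    and tr: "\<And>g h. \<sigma> g h * \<phi> (g + h) = \<sigma> h g * \<phi> (h + g)"
  shows "\<exists>\<tau>. tracial_state AR \<tau> \<and> (\<forall>g. \<tau> (u g) = \<phi> g) \<and>
    (\<forall>T\<in>AR. (\<lambda>n. ell2_cinner (blinfun_apply T (\<xi> n)) (\<xi> n)) \<longlonglongrightarrow> \<tau> T)"
proof -
  define f where "f n T = ell2_cinner (blinfun_apply T (\<xi> n)) (\<xi> n)" for n T
  have f_add: "f n (S + T) = f n S + f n T" for n S T
    by (simp add: f_def blinfun.bilinear_simps ell2_cinner_add_left)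
  have f_diff: "f n (S - T) = f n S - f n T" for n S T
    using f_add[of n "S - T" T] by simp
  have f_scale: "f n (op_scale c T) = c * f n T" for n c T
    by (simp add: f_def op_scale_apply ell2_cinner_scale_left)
  have f_le: "cmod (f n T) \<le> norm T" for n T
    using cmod_ell2_cinner_le[of "T (\<xi> n)" "\<xi> n"] norm_blinfun[of T "\<xi> n"]
    by (simp add: f_def unit)
  have conv: "AR \<subseteq> {T. convergent (\<lambda>n. f n T)}"
  proof (rule AR_subset)
    have "f n 0 = 0" for n by (simp add: f_def ell2_cinner.rep_eq zero_ell2.rep_eq)
    then show "complex_subspace {T. convergent (\<lambda>n. f n T)}"
      by (auto simp: complex_subspace_def f_add f_scale convergent_const
          intro: convergent_add convergent_mult)
    show "u g \<in> {T. convergent (\<lambda>n. f n T)}" for g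
      using lim by (auto simp: f_def convergent_def)
    show "closed {T. convergent (\<lambda>n. f n T)}"
      unfolding closed_sequential_limits
    proof (intro allI impI, elim conjE)
      fix X T assume X: "\<forall>k. X k \<in> {T. convergent (\<lambda>n. f n T)}" "X \<longlonglongrightarrow> T"
      have "Cauchy (\<lambda>n. f n T)"
      proof (rule metric_CauchyI)
        fix e :: real assume "e > 0"
        then obtain k where k: "norm (X k - T) < e / 3"
          using X(2) unfolding LIMSEQ_iff by (meson divide_pos_pos order_refl zero_less_numeral)
        have "Cauchy (\<lambda>n. f n (X k))" using X(1) by (simp add: convergent_Cauchy)
        then obtain M where M: "\<And>m n. m \<ge> M \<Longrightarrow> n \<ge> M \<Longrightarrow> cmod (f m (X k) - f n (X k)) < e / 3"
          using \<open>e > 0\<close> unfolding Cauchy_def dist_norm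
          by (meson divide_pos_pos zero_less_numeral)
        have "cmod (f m T - f n T) < e" if "m \<ge> M" "n \<ge> M" for m n
        proof -
          have "f m T - f n T = (f m (X k) - f n (X k)) - f m (X k - T) + f n (X k - T)"
            by (simp add: f_diff)
          also have "cmod \<dots> \<le> cmod (f m (X k) - f n (X k)) + cmod (f m (X k - T)) + cmod (f n (X k - T))"
            by (meson norm_triangle_ineq norm_triangle_ineq4 order_trans add_right_mono)
          finally show ?thesis using M[OF that] f_le[of m "X k - T"] f_le[of n "X k - T"] k by linarith
        qed
        then show "\<exists>M. \<forall>m\<ge>M. \<forall>n\<ge>M. dist (f m T) (f n T) < e" unfolding dist_norm by blast
      qed
      then show "T \<in> {T. convergent (\<lambda>n. f n T)}" by (simp add: Cauchy_convergent)
    qed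
  qed
  define \<tau> where "\<tau> T = lim (\<lambda>n. f n T)" for T
  have \<tau>: "(\<lambda>n. f n T) \<longlonglongrightarrow> \<tau> T" if "T \<in> AR" for T
    unfolding \<tau>_def using conv that by (auto simp: convergent_LIMSEQ_iff)
  have \<tau>_u: "\<tau> (u g) = \<phi> g" for g
    using \<tau>[OF u_in_AR] lim unfolding f_def by (rule LIMSEQ_unique)
  have \<tau>_add: "\<tau> (S + T) = \<tau> S + \<tau> T" if "S \<in> AR" "T \<in> AR" for S T
    by (rule LIMSEQ_unique[OF \<tau>]) (auto simp: f_add intro!: AR_subspace tendsto_add \<tau> that)
  have \<tau>_scale: "\<tau> (op_scale c T) = c * \<tau> T" if "T \<in> AR" for c T
    by (rule LIMSEQ_unique[OF \<tau>]) (auto simp: f_scale intro!: AR_subspace tendsto_mult_left \<tau> that)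
  have \<tau>_le: "cmod (\<tau> T) \<le> norm T" if "T \<in> AR" for T
    by (rule Lim_bounded[OF tendsto_norm[OF \<tau>[OF that]], of 0]) (simp add: f_le)
  have \<tau>_lim: "(\<lambda>n. \<tau> (X n)) \<longlonglongrightarrow> \<tau> T" if X: "\<And>n. X n \<in> AR" "X \<longlonglongrightarrow> T" for X T
  proof -
    have T: "T \<in> AR" using AR_limit X .
    have "cmod (\<tau> (X n) - \<tau> T) \<le> norm (X n - T)" for n
      using \<tau>_le[of "X n - T"] \<tau>_add[of "X n - T" T] T X(1) AR_subspace(6) by auto
    moreover have "(\<lambda>n. norm (X n - T)) \<longlonglongrightarrow> 0" using X(2) by (simp add: LIM_zero tendsto_norm_zero)
    ultimately have "(\<lambda>n. \<tau> (X n) - \<tau> T) \<longlonglongrightarrow> 0"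
      using Lim_null_comparison[of "\<lambda>n. \<tau> (X n) - \<tau> T" "\<lambda>n. norm (X n - T)" sequentially] by simp
    then show ?thesis by (rule LIM_zero_cancel)
  qed
  have "tracial_state AR \<tau>"
    unfolding tracial_state_def
  proof (intro conjI ballI allI impI)
    fix T S assume T: "T \<in> AR" and S: "S \<in> AR" and adj: "adjoint_of T S"
    have "f n (S o\<^sub>L T) = complex_of_real ((norm (T (\<xi> n)))\<^sup>2)" for n
      using adjoint_of_sym[OF adj] by (simp add: f_def adjoint_of_def ell2_cinner_self_norm)
    then have "f n (S o\<^sub>L T) \<in> \<real>\<^sub>\<ge>\<^sub>0" for n by simp
    then show "\<tau> (S o\<^sub>L T) \<in> \<real>\<^sub>\<ge>\<^sub>0"
      by (intro closed_sequentially[OF closed_nonneg_Reals_complex _ \<tau>[OF AR_compose[OF S T]]]) auto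
  next
    have "f n id_blinfun = 1" for n by (simp add: f_def ell2_cinner_self_norm unit)
    then show "\<tau> id_blinfun = 1" using \<tau>[OF id_in_AR] by (simp add: LIMSEQ_const_iff)
  next
    fix S T assume "S \<in> AR" "T \<in> AR"
    then show "\<tau> (S o\<^sub>L T) = \<tau> (T o\<^sub>L S)"
      by (intro trace_from_generators[of \<tau>] \<tau>_add \<tau>_scale \<tau>_lim) (simp_all add: \<tau>_u tr)
  qed (simp_all add: \<tau>_add \<tau>_scale)
  then show ?thesis using \<tau>_u \<tau> unfolding f_def by blast
qed

subsection \<open>The canonical trace\<close>

definition canonical_trace :: "'g ell2_op \<Rightarrow> complex" where
  "canonical_trace T = ell2_cinner (T (ell2_delta 0)) (ell2_delta 0)"

lemma canonical_trace_u: "canonical_trace (u g) = (if g = 0 then 1 else 0)"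
  by (simp add: canonical_trace_def ell2_cinner_delta u_delta ell2_scale.rep_eq ell2_delta.rep_eq)

lemma tracial_state_canonical_trace: "tracial_state AR canonical_trace"
proof -
  have "\<sigma> g h * canonical_trace (u (g + h)) = \<sigma> h g * canonical_trace (u (h + g))" for g h
  proof (cases "g + h = 0")
    case True
    then have "h = - g" by (simp add: eq_neg_iff_add_eq_0 minus_unique)
    then show ?thesis by (simp add: cocycle_inverse_commute)
  next
    case False
    moreover have "h + g \<noteq> 0" using False by (metis add.inverse_inverse add_eq_0_iff neg_eq_iff_add_eq_0)
    ultimately show ?thesis by (simp add: canonical_trace_u)
  qed
  then obtain \<tau> where \<tau>: "tracial_state AR \<tau>"
    "\<forall>T\<in>AR. (\<lambda>n::nat. ell2_cinner (blinfun_apply T (ell2_delta 0)) (ell2_delta 0)) \<longlonglongrightarrow> \<tau> T"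
    using tracial_state_limit_of_vector_states[of "\<lambda>_. ell2_delta 0" "\<lambda>g. canonical_trace (u g)"]
    by (auto simp: canonical_trace_def norm_ell2_delta)
  then have eq: "canonical_trace T = \<tau> T" if "T \<in> AR" for T
    using that by (simp add: LIMSEQ_const_iff canonical_trace_def)
  note t = \<tau>(1)[unfolded tracial_state_def]
  show ?thesis
    unfolding tracial_state_def
  proof (intro conjI ballI allI impI)
  qed (simp only: eq AR_compose AR_subspace id_in_AR; use t in blast)+
qed

text \<open>
  If \<open>\<tau>\<^sub>0(T\<^sup>*T) = 0\<close> then the trace property gives \<open>T\<delta>\<^sub>g = 0\<close> and \<open>T\<^sup>*\<delta>\<^sub>g = 0\<close> for all \<open>g\<close>;
  the latter says that every coordinate of every \<open>T\<xi>\<close> is zero.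
\<close>

lemma canonical_trace_faithful:
  assumes T: "T \<in> AR" and adj: "adjoint_of T S" and zero: "canonical_trace (S o\<^sub>L T) = 0"
  shows "T = 0"
proof -
  note tr = tracial_state_canonical_trace[unfolded tracial_state_def]
  have S: "S \<in> AR" using AR_adjoint T adj .
  have "S (ell2_delta g) = 0" for g
  proof -
    have "canonical_trace (u_inv g o\<^sub>L ((T o\<^sub>L S) o\<^sub>L u g)) = canonical_trace (((T o\<^sub>L S) o\<^sub>L u g) o\<^sub>L u_inv g)"
      using tr by (auto intro!: AR_compose u_inv_in_AR u_in_AR T S)
    also have "((T o\<^sub>L S) o\<^sub>L u g) o\<^sub>L u_inv g = T o\<^sub>L S"
      by (simp add: blinfun_compose_assoc u_u_inv blinfun_compose_id)
    also have "canonical_trace (T o\<^sub>L S) = 0" using tr T S zero by metis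
    finally have "ell2_cinner (u_inv g (T (S (u g (ell2_delta 0))))) (ell2_delta 0) = 0"
      by (simp add: canonical_trace_def)
    moreover have "ell2_cinner (u_inv g (T (S \<eta>))) \<zeta> = ell2_cinner (S \<eta>) (S (u g \<zeta>))" for \<eta> \<zeta>
      using adjoint_of_sym[OF adjoint_of_u[of g]] adj by (simp add: adjoint_of_def)
    ultimately have "S (u g (ell2_delta 0)) = 0"
      unfolding ell2_cinner_self_norm by (metis ell2_cinner_self_norm of_real_eq_0_iff norm_eq_zero power_zero_numeral zero_eq_power2)
    then show ?thesis by (simp add: u_delta ell2_scale_simps)
  qed
  then have "ell2_apply (T \<xi>) g = 0" for \<xi> g
    using adj ell2_cinner_delta[of "T \<xi>" g] by (simp add: adjoint_of_def ell2_cinner.rep_eq zero_ell2.rep_eq)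
  then show ?thesis by (intro blinfun_eqI ell2_eqI) (simp add: zero_ell2.rep_eq)
qed

end

section \<open>Tracial states are contractive\<close>

context twisted_group
begin

text \<open>
  The map \<open>b \<mapsto> (h + b\<^sup>2)/2\<close> contracts distances by the factor \<open>\<parallel>h\<parallel>\<close> on the self-adjoint elements of
  the ball of radius \<open>\<parallel>h\<parallel>\<close>, and its fixed point satisfies \<open>(1 - b)\<^sup>2 = 1 - h\<close>. This shows that \<open>1 - h\<close>
  has the form \<open>a\<^sup>*a\<close>, on which tracial states are nonnegative.
\<close>

lemma AR_square_root:
  assumes h: "h \<in> AR" "adjoint_of h h" "norm h < 1"
  shows "\<exists>a\<in>AR. adjoint_of a a \<and> a o\<^sub>L a = id_blinfun - h"
proof -
  define r where "r = norm h"
  define s where "s = {b \<in> AR. adjoint_of b b \<and> norm b \<le> r}"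
  define f where "f b = (1 / 2) *\<^sub>R (h + (b o\<^sub>L b))" for b
  have r: "0 \<le> r" "r < 1" "r * r \<le> r" using h by (auto simp: r_def mult_left_le)
  have "\<exists>!b\<in>s. f b = b"
  proof (rule Banach_fix)
    have "closed s"
      unfolding closed_sequential_limits
    proof (intro allI impI, elim conjE)
      fix X b assume X: "\<forall>n. X n \<in> s" "X \<longlonglongrightarrow> b"
      have "b \<in> AR" by (rule AR_limit[OF _ X(2)]) (use X(1) in \<open>simp add: s_def\<close>)
      moreover have "adjoint_of b b" by (rule adjoint_of_limit[OF _ X(2) X(2)]) (use X(1) in \<open>simp add: s_def\<close>)
      moreover have "norm b \<le> r"
        by (rule Lim_bounded[OF tendsto_norm[OF X(2)], of 0]) (use X(1) in \<open>simp add: s_def\<close>)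
      ultimately show "b \<in> s" by (simp add: s_def)
    qed
    then show "complete s" by (simp add: complete_eq_closed)
    show "s \<noteq> {}" using AR_subspace(1) adjoint_of_0 r by (auto simp: s_def)
    show "f ` s \<subseteq> s"
    proof safe
      fix b assume b: "b \<in> s"
      have "norm (b o\<^sub>L b) \<le> r * r"
        using b norm_blinfun_compose[of b b] mult_mono[of "norm b" r "norm b" r] r by (simp add: s_def)
      then have "norm (f b) \<le> r"
        using norm_triangle_ineq[of h "b o\<^sub>L b"] r(3) by (simp add: f_def r_def)
      moreover have "adjoint_of (f b) (f b)"
        unfolding f_def using b
        by (intro adjoint_of_scaleR adjoint_of_add adjoint_of_compose h) (auto simp: s_def)
      ultimately show "f b \<in> s"
        using b by (auto simp: s_def f_def intro!: AR_subspace AR_compose h)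
    qed
    show "dist (f b) (f c) \<le> r * dist b c" if bc: "b \<in> s" "c \<in> s" for b c
    proof -
      have "f b - f c = (1 / 2) *\<^sub>R ((b o\<^sub>L (b - c)) + ((b - c) o\<^sub>L c))"
        by (rule blinfun_eqI) (simp add: f_def blinfun.bilinear_simps scaleR_diff_right scaleR_add_right)
      moreover have "norm (b o\<^sub>L (b - c)) \<le> r * norm (b - c)"
        using bc norm_blinfun_compose[of b "b - c"] mult_right_mono[of "norm b" r "norm (b - c)"]
        by (simp add: s_def)
      moreover have "norm ((b - c) o\<^sub>L c) \<le> norm (b - c) * r"
        using bc norm_blinfun_compose[of "b - c" c] mult_left_mono[of "norm c" r "norm (b - c)"]
        by (simp add: s_def)
      ultimately show "dist (f b) (f c) \<le> r * dist b c"
        using norm_triangle_ineq[of "b o\<^sub>L (b - c)" "(b - c) o\<^sub>L c"]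
        by (simp add: dist_norm mult.commute)
    qed
  qed (use r in auto)
  then obtain b where b: "b \<in> s" "f b = b" by auto
  have bb: "b o\<^sub>L b = 2 *\<^sub>R b - h"
    using arg_cong[OF b(2), of "\<lambda>x. 2 *\<^sub>R x"] by (simp add: f_def algebra_simps)
  have "(id_blinfun - b) o\<^sub>L (id_blinfun - b) = id_blinfun - h"
  proof (rule blinfun_eqI)
    fix \<xi> show "((id_blinfun - b) o\<^sub>L (id_blinfun - b)) \<xi> = (id_blinfun - h) \<xi>"
      using arg_cong[OF bb, of "\<lambda>T. blinfun_apply T \<xi>"]
      by (simp add: blinfun.bilinear_simps scaleR_2)
  qed
  moreover have "adjoint_of (id_blinfun - b) (id_blinfun - b)"
    using b by (intro adjoint_of_diff adjoint_of_id) (simp add: s_def)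
  ultimately show ?thesis
    using b by (intro bexI[of _ "id_blinfun - b"]) (auto simp: s_def intro: AR_subspace id_in_AR)
qed

context
  fixes \<tau>
  assumes tracial: "tracial_state AR \<tau>"
begin

lemma tracial_add: "S \<in> AR \<Longrightarrow> T \<in> AR \<Longrightarrow> \<tau> (S + T) = \<tau> S + \<tau> T"
  and tracial_scale: "T \<in> AR \<Longrightarrow> \<tau> (op_scale c T) = c * \<tau> T"
  and tracial_pos: "T \<in> AR \<Longrightarrow> adjoint_of T S \<Longrightarrow> \<tau> (S o\<^sub>L T) \<in> \<real>\<^sub>\<ge>\<^sub>0"
  and tracial_id: "\<tau> id_blinfun = 1"
  and tracial_commute: "S \<in> AR \<Longrightarrow> T \<in> AR \<Longrightarrow> \<tau> (S o\<^sub>L T) = \<tau> (T o\<^sub>L S)"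
  using tracial AR_adjoint unfolding tracial_state_def by blast+

lemma tracial_scaleR: "T \<in> AR \<Longrightarrow> \<tau> (r *\<^sub>R T) = of_real r * \<tau> T"
  using tracial_scale[of T "of_real r"] by (simp add: op_scale_of_real)

lemma tracial_diff: "S \<in> AR \<Longrightarrow> T \<in> AR \<Longrightarrow> \<tau> (S - T) = \<tau> S - \<tau> T"
  using tracial_add[of S "(-1) *\<^sub>R T"] tracial_scaleR[of T "-1"] by (simp add: AR_subspace)

text \<open>
  For \<open>r > \<parallel>h\<parallel>\<close> the element \<open>1 - h/r\<close> is a square \<open>a\<^sup>*a\<close>, so \<open>1 - \<tau>(h)/r\<close> is real and nonnegative.
\<close>

lemma tracial_selfadjoint:
  assumes h: "h \<in> AR" "adjoint_of h h"
  shows "Im (\<tau> h) = 0" "Re (\<tau> h) \<le> norm h"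
proof -
  have *: "Im (\<tau> h) = 0 \<and> Re (\<tau> h) \<le> r" if r: "norm h < r" for r
  proof -
    have "r > 0" using r norm_ge_zero[of h] by linarith
    then have "norm ((1 / r) *\<^sub>R h) < 1" using r by simp
    then obtain a where a: "a \<in> AR" "adjoint_of a a" "a o\<^sub>L a = id_blinfun - (1 / r) *\<^sub>R h"
      using AR_square_root[of "(1 / r) *\<^sub>R h"] h adjoint_of_scaleR AR_subspace(4) by blast
    have "\<tau> (a o\<^sub>L a) \<in> \<real>\<^sub>\<ge>\<^sub>0" by (rule tracial_pos) (use a in auto)
    moreover have "\<tau> (a o\<^sub>L a) = 1 - of_real (1 / r) * \<tau> h"
      unfolding a(3) using h
      by (simp only: tracial_diff id_in_AR AR_subspace tracial_scaleR tracial_id)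
    ultimately show ?thesis using \<open>r > 0\<close> by (auto simp: complex_nonneg_Reals_iff field_simps)
  qed
  show "Im (\<tau> h) = 0" using *[of "norm h + 1"] by simp
  show "Re (\<tau> h) \<le> norm h" by (rule field_le_epsilon) (use * in auto)
qed

text \<open>
  After multiplying \<open>T\<close> by a unit scalar, \<open>\<tau>(T)\<close> is nonnegative and hence equals the value of \<open>\<tau>\<close>
  at the real part of \<open>T\<close>, to which the self-adjoint case applies.
\<close>

lemma tracial_norm_le:
  assumes T: "T \<in> AR" shows "cmod (\<tau> T) \<le> norm T"
proof -
  obtain c where c: "cmod c = 1" "c * \<tau> T = complex_of_real (cmod (\<tau> T))"
    using exists_unit_rotation by blast
  define R where "R = op_scale c T"
  have R: "R \<in> AR" "norm R = norm T" "\<tau> R = complex_of_real (cmod (\<tau> T))"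
    using T c by (simp_all add: R_def AR_subspace norm_op_scale tracial_scale)
  obtain S where S: "S \<in> AR" "adjoint_of R S" using AR_adjoint_exists R(1) by blast
  define h k where "h = (1 / 2) *\<^sub>R (R + S)" and "k = op_scale (\<i> / 2) (R - S)"
  have hk: "h \<in> AR" "k \<in> AR" using R S by (auto simp: h_def k_def intro: AR_subspace)
  have "adjoint_of h ((1 / 2) *\<^sub>R (S + R))"
    unfolding h_def by (intro adjoint_of_scaleR adjoint_of_add S adjoint_of_sym)
  then have h: "adjoint_of h h" by (simp add: h_def add.commute)
  have "adjoint_of k (op_scale (cnj (\<i> / 2)) (S - R))"
    unfolding k_def by (intro adjoint_of_op_scale adjoint_of_diff S adjoint_of_sym)
  moreover have "op_scale (cnj (\<i> / 2)) (S - R) = k"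
    using op_scale_simps(2)[of "\<i> / 2" "-1" "S - R"] by (simp add: k_def op_scale_simps)
  ultimately have k: "adjoint_of k k" by simp
  have "R = h - op_scale \<i> k"
  proof -
    have "op_scale \<i> k = - ((1 / 2) *\<^sub>R (R - S))"
      by (simp add: k_def op_scale_simps flip: op_scale_of_real op_scale_simps(4))
    then show ?thesis by (simp add: h_def flip: scaleR_right_distrib)
  qed
  then have "\<tau> R = \<tau> h - \<i> * \<tau> k" using hk by (simp only: tracial_diff AR_subspace tracial_scale)
  then have "cmod (\<tau> T) = Re (\<tau> h)"
    using R(3) tracial_selfadjoint(1)[OF hk(2) k] by (metis (no_types, lifting) Re_complex_of_real complex.sel(1) cmod_def Re_i_times minus_complex.sel(1) diff_zero neg_0_equal_iff_equal)
  also have "\<dots> \<le> norm h" by (rule tracial_selfadjoint(2)[OF hk(1) h])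
  also have "\<dots> \<le> norm T"
    using norm_triangle_ineq[of R S] adjoint_of_norm_eq[OF S(2)] R(2) by (simp add: h_def)
  finally show ?thesis .
qed

end

section \<open>Averaging over conjugates\<close>

definition conj_by :: "'g \<Rightarrow> 'g ell2_op \<Rightarrow> 'g ell2_op" where
  "conj_by g T = u g o\<^sub>L T o\<^sub>L u_inv g"

definition conj_avg :: "'g list \<Rightarrow> 'g ell2_op \<Rightarrow> 'g ell2_op" where
  "conj_avg l T = (1 / real (length l)) *\<^sub>R (\<Sum>g\<leftarrow>l. conj_by g T)"

lemma conj_by_add: "conj_by g (S + T) = conj_by g S + conj_by g T"
  and conj_by_scaleR: "conj_by g (r *\<^sub>R T) = r *\<^sub>R conj_by g T"
  and conj_by_0: "conj_by g 0 = 0"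
  by (rule blinfun_eqI, simp add: conj_by_def blinfun.bilinear_simps)+

lemma conj_by_id: "conj_by g id_blinfun = id_blinfun"
  by (simp add: conj_by_def blinfun_compose_id u_u_inv)

lemma conj_by_op_scale: "conj_by g (op_scale c T) = op_scale c (conj_by g T)"
  by (simp add: conj_by_def comp_op_scale u_bounded_ops op_scale_simps)

lemma conj_by_in_AR: "T \<in> AR \<Longrightarrow> conj_by g T \<in> AR"
  by (simp add: conj_by_def AR_compose u_in_AR u_inv_in_AR)

lemma norm_conj_by_le: "norm (conj_by g T) \<le> norm T"
  by (simp add: conj_by_def norm_u_compose_le)

lemma adjoint_of_conj_by: "adjoint_of T S \<Longrightarrow> adjoint_of (conj_by g T) (conj_by g S)"
  unfolding conj_by_def blinfun_compose_assoc
  using adjoint_of_compose[OF adjoint_of_u adjoint_of_compose[OF _ adjoint_of_sym[OF adjoint_of_u]]]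
  by (simp add: blinfun_compose_assoc)

lemma u_inv_compose: "u_inv h o\<^sub>L u_inv g = op_scale (inverse (\<sigma> g h)) (u_inv (g + h))"
proof (rule adjoint_of_unique)
  show "adjoint_of (u g o\<^sub>L u h) (u_inv h o\<^sub>L u_inv g)"
    by (intro adjoint_of_compose adjoint_of_u)
  show "adjoint_of (u g o\<^sub>L u h) (op_scale (inverse (\<sigma> g h)) (u_inv (g + h)))"
    unfolding u_compose cnj_cocycle[symmetric] by (intro adjoint_of_op_scale adjoint_of_u)
qed

text \<open>
  Conjugation is a genuine action of the group: the scalar \<open>\<sigma>(g, h)\<close> from \<open>u g\<close> and \<open>u h\<close> cancels
  against its inverse from their adjoints.
\<close>

lemma conj_by_conj_by:
  assumes "T \<in> AR" shows "conj_by g (conj_by h T) = conj_by (g + h) T"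
proof -
  have "conj_by g (conj_by h T) = ((u g o\<^sub>L u h) o\<^sub>L T) o\<^sub>L (u_inv h o\<^sub>L u_inv g)"
    by (simp add: conj_by_def blinfun_compose_assoc)
  also have "\<dots> = conj_by (g + h) T"
    using assms
    by (simp add: u_compose u_inv_compose op_scale_simps AR_comp_op_scale AR_compose u_in_AR conj_by_def)
  finally show ?thesis .
qed

lemma conj_by_u_commuting:
  assumes "g + h = h + g"
  shows "conj_by g (u h) = op_scale (\<sigma> g h / \<sigma> h g) (u h)"
proof -
  have "u g o\<^sub>L u h = op_scale (\<sigma> g h / \<sigma> h g) (u h o\<^sub>L u g)"
    by (simp add: u_compose assms op_scale_simps)
  then show ?thesis
    by (simp add: conj_by_def op_scale_simps blinfun_compose_assoc u_u_inv blinfun_compose_id)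
qed

lemma conj_by_u: "\<exists>c. cmod c = 1 \<and> conj_by g (u h) = op_scale c (u (g + h - g))"
proof -
  have "conj_by g (u h) = op_scale (\<sigma> g h * (inverse (\<sigma> g (- g)) * \<sigma> (g + h) (- g))) (u (g + h - g))"
    by (simp add: conj_by_def u_inv_def u_compose op_scale_simps comp_op_scale u_bounded_ops)
  then show ?thesis by (intro exI conjI) (auto simp: norm_mult norm_inverse)
qed

subsection \<open>Sums over lists\<close>

lemma sum_list_additive:
  assumes "f 0 = 0" "\<And>x y. f (x + y) = f x + f y"
  shows "f (\<Sum>x\<leftarrow>l. h x) = (\<Sum>x\<leftarrow>l. f (h x))"
  by (induction l) (simp_all add: assms)

lemma norm_sum_list_le_length:
  fixes h :: "'b \<Rightarrow> 'c::real_normed_vector"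
  assumes "\<And>x. norm (h x) \<le> C"
  shows "norm (\<Sum>x\<leftarrow>l. h x) \<le> real (length l) * C"
proof (induction l)
  case (Cons x l)
  then show ?case
    using norm_triangle_ineq[of "h x" "\<Sum>x\<leftarrow>l. h x"] assms[of x] by (simp add: algebra_simps)
qed simp

lemma sum_list_square_le:
  fixes a :: "'b \<Rightarrow> real"
  shows "(\<Sum>x\<leftarrow>l. a x)\<^sup>2 \<le> real (length l) * (\<Sum>x\<leftarrow>l. (a x)\<^sup>2)"
  using sum_squared_le_sum_of_squares[of "\<lambda>i. a (l ! i)" "{..<length l}"]
  by (simp add: sum_list_sum_nth atLeast0LessThan mult.commute)

subsection \<open>Properties of the averages\<close>

lemma conj_avg_add: "conj_avg l (S + T) = conj_avg l S + conj_avg l T"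
  by (simp add: conj_avg_def conj_by_add sum_list_addf scaleR_add_right)

lemma conj_avg_op_scale: "conj_avg l (op_scale c T) = op_scale c (conj_avg l T)"
proof -
  have "(\<Sum>g\<leftarrow>l. op_scale c (conj_by g T)) = op_scale c (\<Sum>g\<leftarrow>l. conj_by g T)"
    by (induction l) (simp_all add: op_scale_simps)
  then show ?thesis by (simp add: conj_avg_def conj_by_op_scale op_scale_simps)
qed

lemma conj_avg_diff: "conj_avg l (S - T) = conj_avg l S - conj_avg l T"
  using conj_avg_add[of l "S - T" T] by simp

lemma conj_avg_id: "l \<noteq> [] \<Longrightarrow> conj_avg l id_blinfun = id_blinfun"
proof -
  have "(\<Sum>g\<leftarrow>l. id_blinfun) = real (length l) *\<^sub>R (id_blinfun :: 'g ell2_op)"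
    by (induction l) (simp_all add: scaleR_add_left)
  moreover assume "l \<noteq> []"
  ultimately show ?thesis by (simp add: conj_avg_def conj_by_id)
qed

lemma norm_conj_avg_le: "norm (conj_avg l T) \<le> norm T"
  using norm_sum_list_le_length[of "\<lambda>g. conj_by g T" "norm T" l, OF norm_conj_by_le]
  by (cases "l = []") (simp_all add: conj_avg_def field_simps)

lemma conj_avg_in_subspace:
  assumes "complex_subspace V" "\<And>g. conj_by g T \<in> V"
  shows "conj_avg l T \<in> V"
proof -
  have "(\<Sum>g\<leftarrow>l. conj_by g T) \<in> V" by (induction l) (auto intro: subspaceD(1,2)[OF assms(1)] assms(2))
  then show ?thesis using assms(1) by (simp add: conj_avg_def subspaceD)
qed

lemma conj_avg_in_AR: "T \<in> AR \<Longrightarrow> conj_avg l T \<in> AR"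
  using conj_avg_in_subspace[OF complex_subspace_u_span] conj_by_in_AR
  by (simp add: reduced_cstar_eq_u_span)

text \<open>
  All sums \<open>g + h\<close>, counted with multiplicity: the average over this list is the composition of the
  averages over the two lists.
\<close>

definition list_add :: "'g list \<Rightarrow> 'g list \<Rightarrow> 'g list" where
  "list_add l m = concat (map (\<lambda>g. map ((+) g) m) l)"

lemma length_list_add: "length (list_add l m) = length l * length m"
  by (induction l) (simp_all add: list_add_def)

lemma conj_avg_conj_avg:
  assumes T: "T \<in> AR"
  shows "conj_avg l (conj_avg m T) =
    (1 / (real (length l) * real (length m))) *\<^sub>R (\<Sum>g\<leftarrow>l. \<Sum>h\<leftarrow>m. conj_by (g + h) T)"
proof -
  have 1: "conj_by g (\<Sum>h\<leftarrow>m. conj_by h T) = (\<Sum>h\<leftarrow>m. conj_by (g + h) T)" for g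
    by (induction m) (simp_all add: conj_by_0 conj_by_add conj_by_conj_by T)
  have 2: "(\<Sum>g\<leftarrow>l. r *\<^sub>R F g) = r *\<^sub>R (\<Sum>g\<leftarrow>l. F g)" for r and F :: "'g \<Rightarrow> 'g ell2_op"
    by (induction l) (simp_all add: scaleR_add_right)
  show ?thesis by (simp add: conj_avg_def conj_by_scaleR 1 2)
qed

lemma conj_avg_list_add:
  assumes T: "T \<in> AR"
  shows "conj_avg (list_add l m) T = conj_avg l (conj_avg m T)"
proof -
  have "(\<Sum>k\<leftarrow>list_add l m. conj_by k T) = (\<Sum>g\<leftarrow>l. \<Sum>h\<leftarrow>m. conj_by (g + h) T)"
    by (induction l) (simp_all add: list_add_def o_def)
  then show ?thesis by (simp add: conj_avg_conj_avg T) (simp add: conj_avg_def length_list_add)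
qed

lemma conj_avg_commute:
  assumes T: "T \<in> AR" and comm: "\<And>g h. g \<in> set l \<Longrightarrow> h \<in> set m \<Longrightarrow> g + h = h + g"
  shows "conj_avg l (conj_avg m T) = conj_avg m (conj_avg l T)"
proof -
  have swap: "(\<Sum>g\<leftarrow>l. \<Sum>h\<leftarrow>m. F g h) = (\<Sum>h\<leftarrow>m. \<Sum>g\<leftarrow>l. F g h)"
    for F :: "'g \<Rightarrow> 'g \<Rightarrow> 'g ell2_op" and l m
    by (induction l) (simp_all add: sum_list_addf)
  have "(\<Sum>g\<leftarrow>l. \<Sum>h\<leftarrow>m. conj_by (g + h) T) = (\<Sum>g\<leftarrow>l. \<Sum>h\<leftarrow>m. conj_by (h + g) T)"
    by (intro arg_cong[of _ _ sum_list] map_cong refl) (metis comm)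
  then show ?thesis by (simp add: conj_avg_conj_avg T swap[of _ m l] mult.commute)
qed

text \<open>
  This is the Schwarz inequality for completely positive maps. For an average of conjugates it follows
  from the inequality between arithmetic and quadratic means, applied to the norms
  \<open>\<parallel>u\<^sub>g T u\<^sub>g\<^sup>* \<xi>\<parallel>\<close> for a fixed vector \<open>\<xi>\<close>.
\<close>

lemma conj_avg_schwarz:
  assumes adj: "adjoint_of T S"
  shows "(norm (conj_avg l T))\<^sup>2 \<le> norm (conj_avg l (S o\<^sub>L T))"
proof -
  define n where "n = real (length l)"
  have vec: "(norm (conj_avg l T \<xi>))\<^sup>2 \<le> norm (conj_avg l (S o\<^sub>L T)) * (norm \<xi>)\<^sup>2" for \<xi>
  proof -
    have sq: "(norm (conj_by g T \<xi>))\<^sup>2 = inner (conj_by g (S o\<^sub>L T) \<xi>) \<xi>" for g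
    proof -
      define v where "v = u_inv g \<xi>"
      have "inner (conj_by g (S o\<^sub>L T) \<xi>) \<xi> = inner (S (T v)) v"
        using adjoint_of_u[of g] by (simp add: conj_by_def v_def inner_ell2_def adjoint_of_def)
      also have "\<dots> = inner (T v) (T v)"
        using adjoint_of_sym[OF adj] by (simp add: inner_ell2_def adjoint_of_def)
      also have "\<dots> = (norm (conj_by g T \<xi>))\<^sup>2"
        by (simp add: conj_by_def v_def norm_u_apply power2_norm_eq_inner)
      finally show ?thesis by simp
    qed
    have "norm (\<Sum>g\<leftarrow>l. conj_by g T \<xi>) \<le> (\<Sum>g\<leftarrow>l. norm (conj_by g T \<xi>))"
    proof (induction l)
      case (Cons g l) then show ?case by simp (meson norm_triangle_le add_left_mono order_trans)
    qed simp
    then have "(norm (\<Sum>g\<leftarrow>l. conj_by g T \<xi>))\<^sup>2 \<le> (\<Sum>g\<leftarrow>l. norm (conj_by g T \<xi>))\<^sup>2"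
      by (intro power_mono) auto
    also have "\<dots> \<le> n * (\<Sum>g\<leftarrow>l. (norm (conj_by g T \<xi>))\<^sup>2)"
      unfolding n_def by (rule sum_list_square_le)
    finally have le: "(norm (\<Sum>g\<leftarrow>l. conj_by g T \<xi>))\<^sup>2 \<le> n * (\<Sum>g\<leftarrow>l. inner (conj_by g (S o\<^sub>L T) \<xi>) \<xi>)"
      by (simp add: sq)
    have "(norm (conj_avg l T \<xi>))\<^sup>2 = (1 / n)\<^sup>2 * (norm (\<Sum>g\<leftarrow>l. conj_by g T \<xi>))\<^sup>2"
      by (simp add: conj_avg_def n_def blinfun.bilinear_simps power_mult_distrib power_divide
          sum_list_additive[where f = "\<lambda>T. blinfun_apply T \<xi>"])
    also have "\<dots> \<le> (1 / n)\<^sup>2 * (n * (\<Sum>g\<leftarrow>l. inner (conj_by g (S o\<^sub>L T) \<xi>) \<xi>))"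
      by (rule mult_left_mono[OF le]) simp
    also have "\<dots> = inner (conj_avg l (S o\<^sub>L T) \<xi>) \<xi>"
      by (simp add: conj_avg_def n_def blinfun.bilinear_simps power2_eq_square inner_add_left
          sum_list_additive[where f = "\<lambda>T. inner (blinfun_apply T \<xi>) \<xi>"])
    also have "\<dots> \<le> norm (conj_avg l (S o\<^sub>L T) \<xi>) * norm \<xi>" by (rule norm_cauchy_schwarz)
    also have "\<dots> \<le> norm (conj_avg l (S o\<^sub>L T)) * norm \<xi> * norm \<xi>"
      by (intro mult_right_mono norm_blinfun) auto
    finally show ?thesis by (simp add: power2_eq_square mult_ac)
  qed
  have "norm (conj_avg l T) \<le> sqrt (norm (conj_avg l (S o\<^sub>L T)))"
  proof (rule norm_blinfun_bound)
    fix \<xi> show "norm (conj_avg l T \<xi>) \<le> sqrt (norm (conj_avg l (S o\<^sub>L T))) * norm \<xi>"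
      by (rule power2_le_imp_le) (use vec[of \<xi>] in \<open>simp_all add: power_mult_distrib\<close>)
  qed simp
  then have "(norm (conj_avg l T))\<^sup>2 \<le> (sqrt (norm (conj_avg l (S o\<^sub>L T))))\<^sup>2"
    by (intro power_mono) auto
  then show ?thesis by simp
qed

end

section \<open>Dixmier averaging along an abelian normal subgroup\<close>

lemma cmod_sum_root_powers_le:
  fixes w :: complex
  assumes "cmod w = 1" "w \<noteq> 1"
  shows "cmod (\<Sum>i<N. w ^ i) \<le> 2 / cmod (w - 1)"
proof -
  have "cmod (w ^ N - 1) \<le> 2"
    using norm_triangle_ineq4[of "w ^ N" 1] assms(1) by (simp add: norm_power)
  moreover have "(\<Sum>i<N. w ^ i) = (w ^ N - 1) / (w - 1)" using assms(2) by (simp add: geometric_sum)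
  ultimately show ?thesis by (simp add: norm_divide divide_right_mono)
qed

context twisted_group
begin

lemma canonical_trace_add: "canonical_trace (S + T) = canonical_trace S + canonical_trace T"
  and canonical_trace_scale: "canonical_trace (op_scale c T) = c * canonical_trace T"
  and canonical_trace_0: "canonical_trace 0 = 0"
  and canonical_trace_id: "canonical_trace id_blinfun = 1"
  by (simp_all add: canonical_trace_def blinfun.bilinear_simps op_scale_apply ell2_cinner_add_left
      ell2_cinner_scale_left ell2_cinner_self_norm norm_ell2_delta
      bounded_bilinear.zero_left[OF bounded_bilinear_ell2_cinner])

lemma canonical_trace_diff: "canonical_trace (S - T) = canonical_trace S - canonical_trace T"
  using canonical_trace_add[of "S - T" T] by simp

lemma cmod_canonical_trace_le: "cmod (canonical_trace T) \<le> norm T"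
  using cmod_ell2_cinner_le[of "T (ell2_delta 0)" "ell2_delta 0"] norm_blinfun[of T "ell2_delta 0"]
  by (simp add: canonical_trace_def norm_ell2_delta)

lemma norm_op_scale_id: "norm (op_scale c id_blinfun :: 'g ell2_op) = cmod c"
proof -
  have "norm (id_blinfun :: 'g ell2_op) = 1"
  proof (rule antisym)
    show "1 \<le> norm (id_blinfun :: 'g ell2_op)"
      using norm_blinfun[of "id_blinfun :: 'g ell2_op" "ell2_delta 0"] by (simp add: norm_ell2_delta)
  qed (rule norm_blinfun_id_le)
  then show ?thesis by (simp add: norm_op_scale)
qed

text \<open>
  The operators that satisfy the Dixmier property with unitaries \<open>u g\<close>, \<open>g \<in> K\<close>. For
  commutative \<open>K\<close> they form a closed subspace, so the property passes from the generators to the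
  whole algebra.
\<close>

definition averages_to_trace :: "'g set \<Rightarrow> 'g ell2_op set" where
  "averages_to_trace K = {T \<in> AR. \<forall>e>0. \<exists>l. set l \<subseteq> K \<and> l \<noteq> [] \<and>
     norm (conj_avg l T - op_scale (canonical_trace T) id_blinfun) < e}"

lemma averages_to_traceE:
  assumes "T \<in> averages_to_trace K" "e > 0"
  obtains l where "set l \<subseteq> K" "l \<noteq> []"
    "norm (conj_avg l T - op_scale (canonical_trace T) id_blinfun) < e"
  using assms unfolding averages_to_trace_def by blast

text \<open>
  Averages over different lists commute, are contractive and fix the scalars; therefore a further
  average does not spoil what an earlier one has achieved, and the set is a subspace.
\<close>

lemma complex_subspace_averages_to_trace:
  assumes K: "0 \<in> K" "\<And>g h. g \<in> K \<Longrightarrow> h \<in> K \<Longrightarrow> g + h \<in> K"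
    "\<And>g h. g \<in> K \<Longrightarrow> h \<in> K \<Longrightarrow> g + h = h + g"
  shows "complex_subspace (averages_to_trace K)"
  unfolding complex_subspace_def
proof (intro conjI ballI allI)
  have "conj_avg [0] 0 = 0" by (simp add: conj_avg_def conj_by_0)
  then show "0 \<in> averages_to_trace K"
    using K(1) by (auto simp: averages_to_trace_def AR_subspace canonical_trace_0 op_scale_zero
        intro!: exI[of _ "[0]"])
next
  fix S T assume ST: "S \<in> averages_to_trace K" "T \<in> averages_to_trace K"
  then have AR: "S \<in> AR" "T \<in> AR" by (auto simp: averages_to_trace_def)
  show "S + T \<in> averages_to_trace K"
    unfolding averages_to_trace_def
  proof (intro CollectI conjI allI impI)
    fix e :: real assume "e > 0"
    then obtain l m where l: "set l \<subseteq> K" "l \<noteq> []"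
        "norm (conj_avg l S - op_scale (canonical_trace S) id_blinfun) < e / 2"
      and m: "set m \<subseteq> K" "m \<noteq> []"
        "norm (conj_avg m T - op_scale (canonical_trace T) id_blinfun) < e / 2"
      using averages_to_traceE[OF ST(1), of "e / 2"] averages_to_traceE[OF ST(2), of "e / 2"]
      by (metis half_gt_zero)
    let ?p = "list_add l m"
    have "conj_avg ?p S = conj_avg m (conj_avg l S)" "conj_avg ?p T = conj_avg l (conj_avg m T)"
      using l(1) m(1) K(3) conj_avg_commute[of S l m]
      by (auto simp: conj_avg_list_add AR subset_iff)
    then have "conj_avg ?p (S + T) - op_scale (canonical_trace (S + T)) id_blinfun
        = conj_avg m (conj_avg l S - op_scale (canonical_trace S) id_blinfun)
          + conj_avg l (conj_avg m T - op_scale (canonical_trace T) id_blinfun)"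
      using l m by (simp add: conj_avg_add conj_avg_diff conj_avg_op_scale conj_avg_id
          canonical_trace_add op_scale_simps)
    also have "norm \<dots> \<le> norm (conj_avg l S - op_scale (canonical_trace S) id_blinfun)
        + norm (conj_avg m T - op_scale (canonical_trace T) id_blinfun)"
      by (intro norm_triangle_le add_mono norm_conj_avg_le)
    also have "\<dots> < e" using l m by linarith
    finally have "norm (conj_avg ?p (S + T) - op_scale (canonical_trace (S + T)) id_blinfun) < e" .
    moreover have "set ?p \<subseteq> K" using l m K(2) by (auto simp: list_add_def)
    moreover have "?p \<noteq> []" using l m length_list_add[of l m] by (metis length_0_conv mult_eq_0_iff)
    ultimately show "\<exists>l. set l \<subseteq> K \<and> l \<noteq> [] \<and>
        norm (conj_avg l (S + T) - op_scale (canonical_trace (S + T)) id_blinfun) < e" by blast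
  qed (simp add: AR AR_subspace)
next
  fix c T assume T: "T \<in> averages_to_trace K"
  show "op_scale c T \<in> averages_to_trace K"
    unfolding averages_to_trace_def
  proof (intro CollectI conjI allI impI)
    fix e :: real assume "e > 0"
    then have "e / (cmod c + 1) > 0" by (simp add: add_nonneg_pos)
    then obtain l where l: "set l \<subseteq> K" "l \<noteq> []"
        "norm (conj_avg l T - op_scale (canonical_trace T) id_blinfun) < e / (cmod c + 1)"
      using T unfolding averages_to_trace_def by blast
    have "conj_avg l (op_scale c T) - op_scale (canonical_trace (op_scale c T)) id_blinfun
        = op_scale c (conj_avg l T - op_scale (canonical_trace T) id_blinfun)"
      by (simp add: conj_avg_op_scale canonical_trace_scale op_scale_diff op_scale_simps)
    then have "norm (conj_avg l (op_scale c T) - op_scale (canonical_trace (op_scale c T)) id_blinfun)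
        \<le> (cmod c + 1) * norm (conj_avg l T - op_scale (canonical_trace T) id_blinfun)"
      by (simp add: norm_op_scale mult_right_mono)
    also have "\<dots> < e"
      using l(3) pos_less_divide_eq[of "cmod c + 1"] norm_ge_zero[of c] by (simp add: mult.commute)
    finally show "\<exists>l. set l \<subseteq> K \<and> l \<noteq> [] \<and>
        norm (conj_avg l (op_scale c T) - op_scale (canonical_trace (op_scale c T)) id_blinfun) < e"
      using l by blast
  qed (use T in \<open>simp add: averages_to_trace_def AR_subspace\<close>)
qed

lemma closed_averages_to_trace: "closed (averages_to_trace K)"
  unfolding closed_sequential_limits
proof (intro allI impI, elim conjE)
  fix X T assume X: "\<forall>n. X n \<in> averages_to_trace K" "X \<longlonglongrightarrow> T"
  show "T \<in> averages_to_trace K"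
    unfolding averages_to_trace_def
  proof (intro CollectI conjI allI impI)
    show "T \<in> AR" by (rule AR_limit[OF _ X(2)]) (use X(1) in \<open>simp add: averages_to_trace_def\<close>)
    fix e :: real assume "e > 0"
    then obtain n where n: "norm (X n - T) < e / 3"
      using X(2) unfolding LIMSEQ_iff by (meson divide_pos_pos order_refl zero_less_numeral)
    obtain l where l: "set l \<subseteq> K" "l \<noteq> []"
        "norm (conj_avg l (X n) - op_scale (canonical_trace (X n)) id_blinfun) < e / 3"
      using averages_to_traceE[OF X(1)[rule_format, of n], of "e / 3"] \<open>e > 0\<close> by auto
    have "conj_avg l T - op_scale (canonical_trace T) id_blinfun =
        (conj_avg l (X n) - op_scale (canonical_trace (X n)) id_blinfun)
        - conj_avg l (X n - T) + op_scale (canonical_trace (X n - T)) id_blinfun"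
      using op_scale_simps(6)[of "canonical_trace (X n - T)" "canonical_trace T" id_blinfun]
      by (simp add: conj_avg_diff canonical_trace_diff algebra_simps)
    also have "norm \<dots> \<le> norm (conj_avg l (X n) - op_scale (canonical_trace (X n)) id_blinfun)
        + norm (conj_avg l (X n - T)) + norm (op_scale (canonical_trace (X n - T)) (id_blinfun :: 'g ell2_op))"
      by (meson norm_triangle_ineq norm_triangle_ineq4 order_trans add_right_mono)
    also have "\<dots> < e"
      using l(3) n norm_conj_avg_le[of l "X n - T"] cmod_canonical_trace_le[of "X n - T"]
      unfolding norm_op_scale_id by linarith
    finally show "\<exists>l. set l \<subseteq> K \<and> l \<noteq> [] \<and>
        norm (conj_avg l T - op_scale (canonical_trace T) id_blinfun) < e" using l by blast
  qed
qed

text \<open>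
  Here \<open>u\<^sub>k u\<^sub>z u\<^sub>k\<^sup>* = \<omega> u\<^sub>z\<close> with \<open>\<omega> \<noteq> 1\<close>. Averaging over the first \<open>N\<close> multiples of \<open>k\<close> multiplies
  \<open>u\<^sub>z\<close> by the mean of the first \<open>N\<close> powers of \<open>\<omega>\<close>, which is at most \<open>2 / (N \<bar>\<omega> - 1\<bar>)\<close>.
\<close>

lemma averages_to_trace_commuting:
  assumes k: "k \<in> K" "k + z = z + k" "\<sigma> k z \<noteq> \<sigma> z k" and "z \<noteq> 0"
    and K: "0 \<in> K" "\<And>g h. g \<in> K \<Longrightarrow> h \<in> K \<Longrightarrow> g + h \<in> K"
  shows "u z \<in> averages_to_trace K"
  unfolding averages_to_trace_def
proof (intro CollectI conjI allI impI)
  fix e :: real assume "e > 0"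
  define w where "w = \<sigma> k z / \<sigma> z k"
  have w: "cmod w = 1" "w \<noteq> 1" using k(3) by (auto simp: w_def norm_divide)
  define m where "m i = ((+) k ^^ i) 0" for i
  have mK: "m i \<in> K" for i by (induction i) (auto simp: m_def K k)
  have conj_m: "conj_by (m i) (u z) = op_scale (w ^ i) (u z)" for i
  proof (induction i)
    case 0
    show ?case using conj_by_u_commuting[of 0 z] by (simp add: m_def op_scale_simps)
  next
    case (Suc i)
    have "conj_by (m (Suc i)) (u z) = conj_by k (conj_by (m i) (u z))"
      by (simp add: m_def conj_by_conj_by u_in_AR)
    then show ?case
      using conj_by_u_commuting[OF k(2)] by (simp add: Suc conj_by_op_scale op_scale_simps w_def mult.commute)
  qed
  obtain N :: nat where N: "real N > 2 / cmod (w - 1) / e" using reals_Archimedean2 by blast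
  then have "real N > 0" using w \<open>e > 0\<close> by (smt (verit) divide_nonneg_nonneg norm_ge_zero)
  let ?l = "map m [0..<N]"
  have "(\<Sum>i\<leftarrow>[0..<N]. conj_by (m i) (u z)) = op_scale (\<Sum>i<N. w ^ i) (u z)"
  proof (induction N)
    case 0 show ?case by (simp add: op_scale_zero)
  next
    case (Suc N) then show ?case by (simp add: conj_m op_scale_simps)
  qed
  then have "norm (conj_avg ?l (u z)) = cmod (\<Sum>i<N. w ^ i) * norm (u z) / N"
    by (simp add: conj_avg_def o_def norm_op_scale)
  also have "\<dots> \<le> (2 / cmod (w - 1)) * 1 / N"
    by (intro divide_right_mono mult_mono cmod_sum_root_powers_le w norm_u_le) auto
  also have "\<dots> < e"
  proof -
    have "2 / cmod (w - 1) < real N * e" using N pos_divide_less_eq[OF \<open>e > 0\<close>] by blast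
    then show ?thesis using pos_divide_less_eq[OF \<open>real N > 0\<close>, of "2 / cmod (w - 1)" e]
      by (simp add: mult.commute)
  qed
  finally have "norm (conj_avg ?l (u z)) < e" .
  then show "\<exists>l. set l \<subseteq> K \<and> l \<noteq> [] \<and>
      norm (conj_avg l (u z) - op_scale (canonical_trace (u z)) id_blinfun) < e"
    using \<open>z \<noteq> 0\<close> mK \<open>real N > 0\<close> by (intro exI[of _ ?l]) (auto simp: canonical_trace_u op_scale_zero)
qed (rule u_in_AR)

text \<open>
  The unitaries of distinct conjugates of \<open>g\<close> are orthogonal for the canonical trace, so the mean \<open>T\<close>
  of \<open>N\<close> of them has \<open>\<tau>\<^sub>0(T\<^sup>*T) = 1/N\<close>. By the Schwarz inequality, an average that brings \<open>T\<^sup>*T\<close> close to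
  its trace makes \<open>T\<close> small.
\<close>

lemma averages_to_trace_infinite_orbit:
  assumes K: "0 \<in> K" "\<And>g h. g \<in> K \<Longrightarrow> h \<in> K \<Longrightarrow> g + h \<in> K"
    "\<And>g h. g \<in> K \<Longrightarrow> h \<in> K \<Longrightarrow> g + h = h + g"
    and in_K: "\<And>k k'. k \<in> K \<Longrightarrow> k' \<in> K \<Longrightarrow> u (- (k + g - k) + (k' + g - k')) \<in> averages_to_trace K"
    and inf: "infinite ((\<lambda>k. k + g - k) ` K)" and "g \<noteq> 0"
  shows "u g \<in> averages_to_trace K"
  unfolding averages_to_trace_def
proof (intro CollectI conjI allI impI)
  fix e :: real assume "e > 0"
  note D = subspaceD[OF complex_subspace_averages_to_trace[OF K]]
  obtain x :: "nat \<Rightarrow> 'g" where x: "inj x" "range x \<subseteq> (\<lambda>k. k + g - k) ` K"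
    using infinite_countable_subset[OF inf] by blast
  then have "\<forall>i. \<exists>k\<in>K. x i = k + g - k" by blast
  then obtain k where k: "\<And>i. k i \<in> K" "\<And>i. x i = k i + g - k i" by metis
  have "\<forall>i. \<exists>c. cmod c = 1 \<and> conj_by (k i) (u g) = op_scale c (u (x i))"
    using conj_by_u k(2) by simp
  then obtain c where c: "\<And>i. cmod (c i) = 1" "\<And>i. conj_by (k i) (u g) = op_scale (c i) (u (x i))"
    by metis
  define U V where "U i = conj_by (k i) (u g)" and "V i = conj_by (k i) (u_inv g)" for i
  have adj: "adjoint_of (U i) (V i)" for i
    unfolding U_def V_def by (intro adjoint_of_conj_by adjoint_of_u)
  have V: "V i = op_scale (cnj (c i)) (u_inv (x i))" for i
    using adj adjoint_of_op_scale[OF adjoint_of_u, of "c i" "x i"]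
    by (intro adjoint_of_unique[OF adj]) (simp add: U_def c)
  have VU: "V i o\<^sub>L U j = op_scale (cnj (c i) * inverse (\<sigma> (x i) (- x i)) * c j * \<sigma> (- x i) (x j)) (u (- x i + x j))" for i j
    unfolding V U_def c u_inv_def
    by (simp add: op_scale_simps comp_op_scale u_bounded_ops u_compose mult_ac)
  have VU_D: "V i o\<^sub>L U j \<in> averages_to_trace K" for i j
    unfolding VU k(2) by (intro D in_K k)
  have VU_tr: "canonical_trace (V i o\<^sub>L U j) = (if i = j then 1 else 0)" for i j
  proof (cases "i = j")
    case True
    have "c j * cnj (c j) = 1" using complex_norm_square[of "c j"] c(1)[of j] by simp
    then have "cnj (c j) * inverse s * (c j * s) = 1" if "s \<noteq> 0" for s
      using that by (simp add: field_simps)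
    then have "V j o\<^sub>L U j = id_blinfun"
      unfolding V U_def c
      by (simp add: op_scale_simps u_inv_def comp_op_scale u_bounded_ops u_compose u_0 cocycle_inverse_commute)
    then show ?thesis using True by (simp add: canonical_trace_id)
  next
    case False
    then have "x i \<noteq> x j" using x(1) by (simp add: inj_eq)
    then have "- x i + x j \<noteq> 0" by (metis add.inverse_inverse add_eq_0_iff neg_eq_iff_add_eq_0)
    then show ?thesis using False unfolding VU by (simp add: canonical_trace_scale canonical_trace_u)
  qed
  obtain N :: nat where N: "real N > 2 / e\<^sup>2" using reals_Archimedean2 by blast
  then have N0: "real N > 0" using \<open>e > 0\<close> by (smt (verit) zero_le_divide_iff zero_le_power2)
  let ?l = "map k [0..<N]"
  define T S where "T = conj_avg ?l (u g)" and "S = (1 / real N) *\<^sub>R (\<Sum>i<N. V i)"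
  have T: "T = (1 / real N) *\<^sub>R (\<Sum>i<N. U i)"
    by (simp add: T_def conj_avg_def U_def o_def interv_sum_list_conv_sum_set_nat atLeast0LessThan)
  have "adjoint_of (\<Sum>i<N. U i) (\<Sum>i<N. V i)"
    by (induction N) (auto intro: adjoint_of_0 adjoint_of_add adj)
  then have adjT: "adjoint_of T S" unfolding T S_def by (rule adjoint_of_scaleR)
  have comp_sum: "R o\<^sub>L (\<Sum>i<N. F i) = (\<Sum>i<N. R o\<^sub>L F i)" "(\<Sum>i<N. F i) o\<^sub>L R = (\<Sum>i<N. F i o\<^sub>L R)"
    for R :: "'g ell2_op" and F and N :: nat
    by (induction N) (simp_all add: bounded_bilinear.add_right[OF bounded_bilinear_blinfun_compose]
        bounded_bilinear.add_left[OF bounded_bilinear_blinfun_compose] 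
        bounded_bilinear.zero_left[OF bounded_bilinear_blinfun_compose]
        bounded_bilinear.zero_right[OF bounded_bilinear_blinfun_compose])
  have ST: "S o\<^sub>L T = (1 / real N * (1 / real N)) *\<^sub>R (\<Sum>j<N. \<Sum>i<N. V i o\<^sub>L U j)"
    unfolding T S_def
    by (simp add: bounded_bilinear.scaleR_left[OF bounded_bilinear_blinfun_compose]
        bounded_bilinear.scaleR_right[OF bounded_bilinear_blinfun_compose] comp_sum
        flip: scaleR_sum_right)
  have sum_D: "(\<Sum>i<n. F i) \<in> averages_to_trace K" if "\<And>i. F i \<in> averages_to_trace K" for F and n :: nat
    by (induction n) (simp_all add: D that)
  have ST_D: "S o\<^sub>L T \<in> averages_to_trace K" unfolding ST by (intro D sum_D VU_D)
  have tr_sum: "canonical_trace (\<Sum>i<n. F i) = (\<Sum>i<n. canonical_trace (F i))" for F and n :: nat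
    by (induction n) (simp_all add: canonical_trace_0 canonical_trace_add)
  have tr_ST: "canonical_trace (S o\<^sub>L T) = of_real (1 / N)"
    unfolding ST op_scale_of_real[symmetric] canonical_trace_scale tr_sum VU_tr using N0 by simp
  obtain l where l: "set l \<subseteq> K" "l \<noteq> []"
      "norm (conj_avg l (S o\<^sub>L T) - op_scale (canonical_trace (S o\<^sub>L T)) id_blinfun) < 1 / N"
    using averages_to_traceE[OF ST_D, of "1 / N"] N0 by auto
  have "norm (conj_avg l (S o\<^sub>L T)) < 2 / N"
    using norm_triangle_sub[of "conj_avg l (S o\<^sub>L T)" "op_scale (canonical_trace (S o\<^sub>L T)) id_blinfun"] l(3)
    unfolding norm_op_scale_id tr_ST by (simp add: norm_divide)
  then have "(norm (conj_avg l T))\<^sup>2 < 2 / N" using conj_avg_schwarz[OF adjT, of l] by linarith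
  also have "\<dots> < e\<^sup>2" using N N0 \<open>e > 0\<close> by (simp add: field_simps)
  finally have "norm (conj_avg l T) < e" using \<open>e > 0\<close> by (simp add: power_less_imp_less_base)
  moreover have "conj_avg l T = conj_avg (list_add l ?l) (u g)"
    unfolding T_def by (simp add: conj_avg_list_add u_in_AR)
  moreover have "set (list_add l ?l) \<subseteq> K" using l k K(2) by (auto simp: list_add_def)
  moreover have "list_add l ?l \<noteq> []"
    using l N0 length_list_add[of l ?l] by (metis length_0_conv length_map length_upt mult_eq_0_iff of_nat_0_less_iff less_irrefl minus_nat.diff_0)
  ultimately show "\<exists>l. set l \<subseteq> K \<and> l \<noteq> [] \<and>
      norm (conj_avg l (u g) - op_scale (canonical_trace (u g)) id_blinfun) < e"
    using \<open>g \<noteq> 0\<close> by (intro exI[of _ "list_add l ?l"]) (simp add: canonical_trace_u op_scale_zero)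
qed (rule u_in_AR)

text \<open>
  An abelian normal subgroup \<open>K\<close> suffices if the commutator of the cocycle is nondegenerate on \<open>K\<close> and
  the elements outside \<open>K\<close> have infinitely many \<open>K\<close>-conjugates. Normality ensures that the quotient
  \<open>- g\<^sub>1 + g\<^sub>2\<close> of two \<open>K\<close>-conjugates of \<open>g\<close> lies in \<open>K\<close>, where nondegeneracy applies.
\<close>

lemma AR_averages_to_trace:
  assumes K: "0 \<in> K" "\<And>g h. g \<in> K \<Longrightarrow> h \<in> K \<Longrightarrow> g + h \<in> K" "\<And>g. g \<in> K \<Longrightarrow> - g \<in> K"
    "\<And>g h. g \<in> K \<Longrightarrow> h \<in> K \<Longrightarrow> g + h = h + g" "\<And>g k. k \<in> K \<Longrightarrow> g + k - g \<in> K"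
    and nondegenerate: "\<And>z. z \<in> K \<Longrightarrow> z \<noteq> 0 \<Longrightarrow> \<exists>k\<in>K. \<sigma> k z \<noteq> \<sigma> z k"
    and infinite_orbits: "\<And>g. g \<notin> K \<Longrightarrow> infinite ((\<lambda>k. k + g - k) ` K)"
  shows "AR \<subseteq> averages_to_trace K"
proof (rule AR_subset)
  have in_K: "u z \<in> averages_to_trace K" if z: "z \<in> K" for z
  proof (cases "z = 0")
    case True
    have "conj_avg [0] id_blinfun = id_blinfun" by (rule conj_avg_id) simp
    then show ?thesis
      using K(1) True by (auto simp: averages_to_trace_def id_in_AR u_0 canonical_trace_id op_scale_simps
        intro!: exI[of _ "[0]"])
  next
    case False
    with nondegenerate z obtain k where "k \<in> K" "\<sigma> k z \<noteq> \<sigma> z k" by blast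
    then show ?thesis using K z False by (intro averages_to_trace_commuting[of k]) auto
  qed
  show "u g \<in> averages_to_trace K" for g
  proof (cases "g \<in> K")
    case False
    show ?thesis
    proof (rule averages_to_trace_infinite_orbit)
      fix k k' assume k: "k \<in> K" "k' \<in> K"
      have "- (k + g - k) + (k' + g - k') = k + ((- g) + (- k + k') - (- g)) + - k'"
        by (simp add: minus_add add.assoc diff_conv_add_uminus del: add_uminus_conv_diff)
      also have "\<dots> \<in> K" by (intro K k)
      finally show "u (- (k + g - k) + (k' + g - k')) \<in> averages_to_trace K" by (rule in_K)
    qed (use K False infinite_orbits in auto)
  qed (rule in_K)
qed (use K in \<open>auto intro!: complex_subspace_averages_to_trace closed_averages_to_trace\<close>)

text \<open>
  A tracial state \<open>\<tau>\<close> is constant on conjugates, hence on averages. Since it is contractive, \<open>\<tau>(T)\<close> is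
  arbitrarily close to its value at the scalar \<open>\<tau>\<^sub>0(T)\<close>.
\<close>

lemma unique_trace_if_averages:
  assumes av: "AR \<subseteq> averages_to_trace K"
  shows "unique_trace_property \<sigma>"
  unfolding unique_trace_property_def has_unique_tracial_state_def
proof (intro exI conjI allI impI ballI)
  show "tracial_state AR canonical_trace" by (rule tracial_state_canonical_trace)
  fix \<tau> T assume \<tau>: "tracial_state AR \<tau>" and T: "T \<in> AR"
  have conj: "\<tau> (conj_by g T) = \<tau> T" for g
  proof -
    have "\<tau> (conj_by g T) = \<tau> (u_inv g o\<^sub>L (u g o\<^sub>L T))"
      unfolding conj_by_def by (intro tracial_commute[OF \<tau>] AR_compose u_in_AR u_inv_in_AR T)
    then show ?thesis by (simp add: u_inv_u blinfun_compose_id flip: blinfun_compose_assoc)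
  qed
  have avg: "\<tau> (conj_avg l T) = \<tau> T" if "l \<noteq> []" for l
  proof -
    have "(\<Sum>g\<leftarrow>l. conj_by g T) \<in> AR \<and> \<tau> (\<Sum>g\<leftarrow>l. conj_by g T) = of_nat (length l) * \<tau> T"
      using tracial_scaleR[OF \<tau> AR_subspace(1), of 0]
      by (induction l) (auto simp: AR_subspace conj_by_in_AR T tracial_add[OF \<tau>] conj algebra_simps)
    then show ?thesis using that by (simp add: conj_avg_def tracial_scaleR[OF \<tau>])
  qed
  have "cmod (\<tau> T - canonical_trace T) \<le> 0 + e" if "e > 0" for e
  proof -
    obtain l where l: "l \<noteq> []" "norm (conj_avg l T - op_scale (canonical_trace T) id_blinfun) < e"
      using averages_to_traceE[OF subsetD[OF av T] \<open>e > 0\<close>] by metis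
    have "\<tau> (conj_avg l T - op_scale (canonical_trace T) id_blinfun) = \<tau> T - canonical_trace T"
      by (simp add: tracial_diff[OF \<tau>] tracial_scale[OF \<tau>] tracial_id[OF \<tau>] conj_avg_in_AR T
          AR_subspace id_in_AR avg[OF l(1)])
    then show ?thesis
      using l(2) tracial_norm_le[OF \<tau>, of "conj_avg l T - op_scale (canonical_trace T) id_blinfun"]
      by (simp add: conj_avg_in_AR T AR_subspace id_in_AR)
  qed
  then have "cmod (\<tau> T - canonical_trace T) \<le> 0" by (rule field_le_epsilon)
  then show "\<tau> T = canonical_trace T" by simp
qed

text \<open>
  A nonzero closed ideal contains some \<open>T\<^sup>*T \<noteq> 0\<close>, hence all averages of its conjugates, hence in
  the limit the nonzero scalar \<open>\<tau>\<^sub>0(T\<^sup>*T)\<close>.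
\<close>

lemma cstar_simple_if_averages:
  assumes av: "AR \<subseteq> averages_to_trace K"
  shows "cstar_simple \<sigma>"
  unfolding cstar_simple_def simple_cstar_def
proof (intro conjI allI impI)
  show "AR \<noteq> {0}"
    using id_in_AR canonical_trace_0 canonical_trace_id by (metis singletonD zero_neq_one)
  fix I assume I: "closed_ideal AR I"
  have sub: "I \<subseteq> AR" "complex_subspace I" "closed I"
    and ideal: "\<And>S T. S \<in> AR \<Longrightarrow> T \<in> I \<Longrightarrow> S o\<^sub>L T \<in> I" "\<And>S T. S \<in> AR \<Longrightarrow> T \<in> I \<Longrightarrow> T o\<^sub>L S \<in> I"
    using I by (auto simp: closed_ideal_def)
  show "I = {0} \<or> I = AR"
  proof (rule disjCI)
    assume "I \<noteq> AR"
    show "I = {0}"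
    proof (rule ccontr)
      assume "I \<noteq> {0}"
      then obtain T where T: "T \<in> I" "T \<noteq> 0" using subspaceD(1)[OF sub(2)] by blast
      then obtain S where S: "S \<in> AR" "adjoint_of T S" using sub(1) AR_adjoint_exists by blast
      define R where "R = S o\<^sub>L T"
      define c where "c = canonical_trace R"
      have R: "R \<in> I" "R \<in> AR" using ideal(1)[OF S(1) T(1)] sub(1) by (auto simp: R_def)
      have c: "c \<noteq> 0" using canonical_trace_faithful[OF _ S(2)] T sub(1) by (auto simp: c_def R_def)
      have "\<exists>X\<in>I. dist X (op_scale c id_blinfun) < e" if "e > 0" for e
      proof -
        obtain l where l: "norm (conj_avg l R - op_scale c id_blinfun) < e"
          using averages_to_traceE[OF subsetD[OF av R(2)] \<open>e > 0\<close>] unfolding c_def by metis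
        moreover have "conj_avg l R \<in> I"
          by (rule conj_avg_in_subspace[OF sub(2)])
            (auto simp: conj_by_def intro: ideal R u_in_AR u_inv_in_AR)
        ultimately show ?thesis by (auto simp: dist_norm)
      qed
      then have "op_scale c id_blinfun \<in> I" using sub(3) by (metis closed_approachable)
      then have "op_scale (inverse c) (op_scale c id_blinfun) \<in> I" by (rule subspaceD(3)[OF sub(2)])
      then have "id_blinfun \<in> I" using c by (simp add: op_scale_simps)
      then have "T \<in> I" if "T \<in> AR" for T using ideal(1)[OF that] by (metis blinfun_compose_id(1))
      then show False using sub(1) \<open>I \<noteq> AR\<close> by blast
    qed
  qed
qed

end

section \<open>Traces supported on an amenable subgroup\<close>

context twisted_group
begin

text \<open>
  Since \<open>q\<close> trivializes the cocycle on \<open>H\<close>, the restriction of \<open>q\<close> to a Folner set \<open>F\<close> is almost an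
  eigenvector of \<open>u\<^sub>z\<close> with eigenvalue \<open>q(z)\<^sup>-\<^sup>1\<close>, for \<open>z \<in> H\<close>: only the boundary \<open>F - (z + F)\<close> interferes.
  The resulting vector states vanish on \<open>u\<^sub>g\<close> for \<open>g \<notin> H\<close>, because \<open>g + F\<close> is then disjoint from \<open>H\<close>.
\<close>

lemma trace_from_folner_sets:
  assumes H: "\<And>z w. z \<in> H \<Longrightarrow> w \<in> H \<Longrightarrow> z - w \<in> H"
    and q: "\<And>z. z \<in> H \<Longrightarrow> cmod (q z) = 1"
      "\<And>z w. z \<in> H \<Longrightarrow> w \<in> H \<Longrightarrow> q (z + w) = \<sigma> z w * q z * q w"
    and F: "\<And>n. finite (F n)" "\<And>n. F n \<noteq> {}" "\<And>n. F n \<subseteq> H"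
      "\<And>z. z \<in> H \<Longrightarrow> (\<lambda>n. real (card (F n \<inter> (+) z ` F n)) / real (card (F n))) \<longlonglongrightarrow> 1"
    and \<phi>: "\<phi> = (\<lambda>g. if g \<in> H then cnj (q g) else 0)"
    and tr: "\<And>g h. \<sigma> g h * \<phi> (g + h) = \<sigma> h g * \<phi> (h + g)"
  shows "\<exists>\<tau>. tracial_state AR \<tau> \<and> (\<forall>g. \<tau> (u g) = \<phi> g)"
proof -
  define s where "s n = complex_of_real (1 / sqrt (real (card (F n))))" for n
  define \<xi> where "\<xi> n = (\<Sum>x\<in>F n. ell2_scale (s n * q x) (ell2_delta x))" for n
  have card: "real (card (F n)) > 0" for n using F(1,2) by (simp add: card_gt_0_iff)
  have ss: "s n * s n = of_real (1 / real (card (F n)))" for n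
    unfolding s_def of_real_mult[symmetric] by simp
  have sum_apply: "ell2_apply (\<Sum>x\<in>A. f x) y = (\<Sum>x\<in>A. ell2_apply (f x) y)"
    for A :: "'g set" and f y
    by (induction A rule: infinite_finite_induct) (simp_all add: zero_ell2.rep_eq plus_ell2.rep_eq)
  have \<xi>: "ell2_apply (\<xi> n) y = (if y \<in> F n then s n * q y else 0)" for n y
    using F(1)[of n]
    by (simp add: \<xi>_def sum_apply ell2_scale.rep_eq ell2_delta.rep_eq if_distrib[of "\<lambda>z. _ * z"] cong: if_cong)
  have cinner: "ell2_cinner \<eta> (\<xi> n) = (\<Sum>x\<in>F n. s n * cnj (q x) * ell2_apply \<eta> x)" for \<eta> n
    unfolding \<xi>_def bounded_bilinear.sum_right[OF bounded_bilinear_ell2_cinner]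
    by (simp add: ell2_cinner_scale_right ell2_cinner_delta s_def)
  have H0: "0 \<in> H" using F(2)[of 0] F(3)[of 0] H by (metis all_not_in_conv diff_self subsetD)
  have coeff: "ell2_cinner (u g (\<xi> n)) (\<xi> n) =
      (if g \<in> H then cnj (q g) * of_real (real (card (F n \<inter> (+) g ` F n)) / real (card (F n))) else 0)" for g n
  proof -
    have summand: "s n * cnj (q x) * ell2_apply (u g (\<xi> n)) x =
        (if x \<in> (+) g ` F n \<and> g \<in> H then s n * s n * cnj (q g) else 0)" if x: "x \<in> F n" for x
    proof (cases "- g + x \<in> F n")
      case True
      have xH: "x \<in> H" "- g + x \<in> H" using x True F(3) by auto
      have gx: "g = x - (- g + x)" by (simp add: diff_conv_add_uminus minus_add add.assoc[symmetric] del: add_uminus_conv_diff)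
      have g: "g \<in> H" by (subst gx) (intro H xH)
      have qx: "q x = \<sigma> g (- g + x) * q g * q (- g + x)"
        using q(2)[OF g xH(2)] by (simp add: add.assoc[symmetric])
      have "cnj (q x) * (\<sigma> g (- g + x) * q (- g + x)) =
          cnj (q g) * (cnj (\<sigma> g (- g + x)) * \<sigma> g (- g + x)) * (cnj (q (- g + x)) * q (- g + x))"
        by (simp add: qx mult_ac)
      moreover have "cnj z * z = 1" if "cmod z = 1" for z
        using complex_norm_square[of z] that by (simp add: mult.commute)
      ultimately have "cnj (q x) * (\<sigma> g (- g + x) * q (- g + x)) = cnj (q g)"
        using q(1)[OF xH(2)] by simp
      moreover have "x \<in> (+) g ` F n" using True by (intro image_eqI[of _ _ "- g + x"]) (simp_all add: add.assoc[symmetric])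
      ultimately show ?thesis using True g by (simp add: u_apply \<xi> mult_ac)
    next
      case False
      then have "x \<notin> (+) g ` F n" by (auto simp: add.assoc[symmetric])
      then show ?thesis using False by (simp add: u_apply \<xi>)
    qed
    have "ell2_cinner (u g (\<xi> n)) (\<xi> n) =
        (\<Sum>x\<in>F n. if x \<in> (+) g ` F n \<and> g \<in> H then s n * s n * cnj (q g) else 0)"
      unfolding cinner by (rule sum.cong) (simp_all add: summand)
    also have "\<dots> = (if g \<in> H then of_nat (card (F n \<inter> (+) g ` F n)) * (s n * s n * cnj (q g)) else 0)"
      using F(1)[of n] by (simp add: sum.inter_restrict[symmetric])
    finally show ?thesis by (simp add: ss)
  qed
  have q0: "q 0 = 1"
    using q(1)[OF H0] q(2)[OF H0 H0] by (metis add_0 cocycle_0(1) mult_1 mult_cancel_right2 norm_zero zero_neq_one)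
  have "norm (\<xi> n) = 1" for n
  proof -
    have "complex_of_real ((norm (\<xi> n))\<^sup>2) = 1"
      using coeff[of 0 n] H0 q0 card[of n] by (simp add: u_0 ell2_cinner_self_norm image_ident)
    then have "(norm (\<xi> n))\<^sup>2 = 1" by (simp only: of_real_eq_1_iff)
    then show ?thesis using norm_ge_zero[of "\<xi> n"] by (simp add: power2_eq_1_iff)
  qed
  moreover have "(\<lambda>n. ell2_cinner (u g (\<xi> n)) (\<xi> n)) \<longlonglongrightarrow> \<phi> g" for g
  proof (cases "g \<in> H")
    case True
    then have "(\<lambda>n. cnj (q g) * of_real (real (card (F n \<inter> (+) g ` F n)) / real (card (F n)))) \<longlonglongrightarrow> cnj (q g) * of_real 1"
      by (intro tendsto_intros F)
    then show ?thesis using True by (simp add: coeff \<phi>)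
  qed (simp add: coeff \<phi>)
  ultimately show ?thesis
    using tracial_state_limit_of_vector_states[of \<xi> \<phi>] tr by blast
qed

end

section \<open>Folner sets in subgroups of the lamp group\<close>

text \<open>
  For \<open>k = (d + 1) j\<close>, Bernoulli's inequality bounds \<open>c\<^sup>k\<close> below by the power \<open>d + 1\<close> of a linear
  function \<open>p\<close> of \<open>j\<close>, whereas the left-hand side is at most a constant multiple of \<open>p\<^sup>d\<close>.
\<close>

lemma exponential_beats_polynomial:
  fixes b c :: real
  assumes "c > 1" "b \<ge> 0"
  shows "\<exists>k::nat. (b * real k + 1) ^ d < c ^ k"
proof -
  define a where "a = c - 1"
  define b' where "b' = b * real (Suc d)"
  define r where "r = 1 + b' / a"
  have a: "a > 0" and b': "b' \<ge> 0" using assms by (auto simp: a_def b'_def)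
  then have r: "r \<ge> 1" "b' \<le> r * a" by (simp_all add: r_def field_simps)
  obtain j :: nat where j: "r ^ d < real j * a" using reals_Archimedean3[OF a] by blast
  define p where "p = 1 + real j * a"
  have p: "p > 0" "r ^ d < p" using j a by (simp_all add: p_def add_pos_nonneg)
  have "b' * real j + 1 \<le> r * a * real j + r" using r by (intro add_mono mult_right_mono) auto
  then have "b' * real j + 1 \<le> r * p" by (simp add: p_def algebra_simps)
  then have "(b' * real j + 1) ^ d \<le> (r * p) ^ d" using b' by (intro power_mono) auto
  also have "\<dots> = r ^ d * p ^ d" by (rule power_mult_distrib)
  also have "\<dots> < p * p ^ d" using p by (intro mult_strict_right_mono) auto
  also have "p * p ^ d = p ^ Suc d" by simp
  also have "\<dots> \<le> (c ^ j) ^ Suc d"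
    using Bernoulli_inequality[of a j] a p by (intro power_mono) (simp_all add: p_def a_def mult.commute)
  also have "\<dots> = c ^ (Suc d * j)" by (simp only: power_mult[symmetric] mult.commute)
  finally have "(b' * real j + 1) ^ d < c ^ (Suc d * j)" .
  moreover have "b' * real j = b * real (Suc d * j)" by (simp add: b'_def algebra_simps)
  ultimately show ?thesis by metis
qed

definition coeff_box :: "int_sum set \<Rightarrow> nat \<Rightarrow> nat \<Rightarrow> int_sum set" where
  "coeff_box H m N = {x \<in> H. Poly_Mapping.keys x \<subseteq> {- int m..int m} \<and>
     (\<forall>k. \<bar>Poly_Mapping.lookup x k\<bar> \<le> int N)}"

lemma finite_coeff_box: "finite (coeff_box H m N)"
  and card_coeff_box_le: "card (coeff_box H m N) \<le> (2 * N + 1) ^ (2 * m + 1)"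
proof -
  let ?P = "PiE {- int m..int m} (\<lambda>_. {- int N..int N})"
  let ?f = "\<lambda>x. restrict (Poly_Mapping.lookup x) {- int m..int m}"
  have inj: "inj_on ?f (coeff_box H m N)"
  proof (rule inj_onI)
    fix x y assume xy: "x \<in> coeff_box H m N" "y \<in> coeff_box H m N" "?f x = ?f y"
    show "x = y"
    proof (rule poly_mapping_eqI)
      fix k show "Poly_Mapping.lookup x k = Poly_Mapping.lookup y k"
      proof (cases "k \<in> {- int m..int m}")
        case True then show ?thesis using fun_cong[OF xy(3), of k] by simp
      next
        case False
        then have "k \<notin> Poly_Mapping.keys x" "k \<notin> Poly_Mapping.keys y"
          using xy by (auto simp: coeff_box_def)
        then show ?thesis by (simp add: in_keys_iff)
      qed
    qed
  qed
  have sub: "?f ` coeff_box H m N \<subseteq> ?P"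
    unfolding coeff_box_def by (auto simp: abs_le_iff minus_le_iff)
  have fin: "finite ?P" by (intro finite_PiE) auto
  show "finite (coeff_box H m N)" using inj_on_finite[OF inj sub fin] .
  have "card (coeff_box H m N) \<le> card ?P" by (rule card_inj_on_le[OF inj sub fin])
  also have "card ?P = (2 * N + 1) ^ (2 * m + 1)" by (simp add: card_PiE nat_add_distrib nat_mult_distrib)
  finally show "card (coeff_box H m N) \<le> (2 * N + 1) ^ (2 * m + 1)" .
qed

text \<open>
  For a fixed support the boxes in a subgroup grow polynomially with the bound on the entries.
  If enlarging the bound by \<open>m\<close> always multiplied the cardinality by more than \<open>1 + 1/m\<close>, the growth
  would be exponential.
\<close>

lemma coeff_box_growth:
  assumes "0 \<in> H" "m > 0"
  shows "\<exists>N. real (card (coeff_box H m (N + m))) \<le> (1 + 1 / real m) * real (card (coeff_box H m N))"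
proof (rule ccontr)
  assume "\<not> ?thesis"
  then have less: "(1 + 1 / real m) * real (card (coeff_box H m N)) < real (card (coeff_box H m (N + m)))" for N
    by (simp add: not_le)
  have "0 \<in> coeff_box H m 0" using assms by (simp add: coeff_box_def)
  then have "card (coeff_box H m 0) \<ge> 1" using finite_coeff_box[of H m 0] by (metis One_nat_def Suc_leI card_gt_0_iff empty_iff)
  have pow: "(1 + 1 / real m) ^ k \<le> real (card (coeff_box H m (k * m)))" for k
  proof (induction k)
    case (Suc k)
    have "(1 + 1 / real m) ^ Suc k \<le> (1 + 1 / real m) * real (card (coeff_box H m (k * m)))"
      using Suc by (simp add: mult_left_mono)
    also have "\<dots> \<le> real (card (coeff_box H m (Suc k * m)))"
      using less[of "k * m"] by (simp add: add.commute)
    finally show ?case .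
  qed (use \<open>card (coeff_box H m 0) \<ge> 1\<close> in simp)
  obtain k where k: "(2 * real k * real m + 1) ^ (2 * m + 1) < (1 + 1 / real m) ^ k"
    using exponential_beats_polynomial[of "1 + 1 / real m" "2 * real m" "2 * m + 1"] assms
    by (auto simp: mult.assoc mult.commute[of "real m"])
  have base: "real (2 * (k * m) + 1) = 2 * real k * real m + 1" by simp
  have "real (card (coeff_box H m (k * m))) \<le> real ((2 * (k * m) + 1) ^ (2 * m + 1))"
    using card_coeff_box_le of_nat_le_iff by blast
  also have "\<dots> = (2 * real k * real m + 1) ^ (2 * m + 1)"
    unfolding of_nat_power base ..
  finally show False using pow[of k] k by linarith
qed

text \<open>
  The sets are boxes with support in \<open>{- m..m}\<close> and entries bounded by \<open>N + m\<close>, where \<open>N\<close> is chosen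
  for \<open>m\<close> such that the smaller box with bound \<open>N\<close> is almost as large. Every fixed element moves the
  smaller box into the larger one as soon as \<open>m\<close> exceeds its support and its entries.
\<close>

lemma exists_folner_sets:
  fixes H :: "int_sum set"
  assumes H: "0 \<in> H" "\<And>z w. z \<in> H \<Longrightarrow> w \<in> H \<Longrightarrow> z + w \<in> H"
  shows "\<exists>F :: nat \<Rightarrow> int_sum set. (\<forall>n. finite (F n) \<and> F n \<noteq> {} \<and> F n \<subseteq> H) \<and>
    (\<forall>z\<in>H. (\<lambda>n. real (card (F n \<inter> (+) z ` F n)) / real (card (F n))) \<longlonglongrightarrow> 1)"
proof -
  have "\<forall>n. \<exists>N. real (card (coeff_box H (Suc n) (N + Suc n)))
      \<le> (1 + 1 / real (Suc n)) * real (card (coeff_box H (Suc n) N))"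
    by (intro allI coeff_box_growth H) simp
  then obtain N where N: "\<And>n. real (card (coeff_box H (Suc n) (N n + Suc n)))
      \<le> (1 + 1 / real (Suc n)) * real (card (coeff_box H (Suc n) (N n)))"
    by metis
  define F where "F n = coeff_box H (Suc n) (N n + Suc n)" for n
  have fin: "finite (F n)" for n by (simp add: F_def finite_coeff_box)
  have "0 \<in> F n" for n using H(1) by (simp add: F_def coeff_box_def)
  then have ne: "F n \<noteq> {}" for n by blast
  have card: "real (card (F n)) > 0" for n using fin ne by (simp add: card_gt_0_iff)
  have lim: "(\<lambda>n. real (card (F n \<inter> (+) z ` F n)) / real (card (F n))) \<longlonglongrightarrow> 1" if z: "z \<in> H" for z
  proof (rule tendsto_sandwich)
    show "\<forall>\<^sub>F n in sequentially. real (card (F n \<inter> (+) z ` F n)) / real (card (F n)) \<le> 1"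
      using card fin by (intro always_eventually allI) (simp add: card_mono)
    obtain M :: nat where M: "\<And>k. k \<in> Poly_Mapping.keys z \<Longrightarrow> \<bar>k\<bar> \<le> int M"
      "\<And>k. \<bar>Poly_Mapping.lookup z k\<bar> \<le> int M"
    proof -
      \<comment> \<open>a common bound for the positions and the values of the entries of \<open>z\<close>\<close>
      define M where "M = (\<Sum>k\<in>Poly_Mapping.keys z. nat \<bar>k\<bar> + nat \<bar>Poly_Mapping.lookup z k\<bar>)"
      have le: "nat \<bar>k\<bar> + nat \<bar>Poly_Mapping.lookup z k\<bar> \<le> M" if "k \<in> Poly_Mapping.keys z" for k
        unfolding M_def by (rule member_le_sum) (use that in auto)
      show ?thesis
      proof (rule that[of M])
        show "\<bar>k\<bar> \<le> int M" if "k \<in> Poly_Mapping.keys z" for k using le[OF that] by linarith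
        show "\<bar>Poly_Mapping.lookup z k\<bar> \<le> int M" for k
          using le[of k] by (cases "k \<in> Poly_Mapping.keys z") (auto simp: in_keys_iff)
      qed
    qed
    have "1 / (1 + 1 / real (Suc n)) \<le> real (card (F n \<inter> (+) z ` F n)) / real (card (F n))"
      if n: "n \<ge> M" for n
    proof -
      let ?B = "coeff_box H (Suc n) (N n)"
      have "(+) z ` ?B \<subseteq> F n \<inter> (+) z ` F n"
      proof safe
        fix x assume x: "x \<in> ?B"
        have "x \<in> F n"
          using x unfolding F_def coeff_box_def by (auto intro: order_trans[where y = "int (N n)"])
        then show "z + x \<in> (+) z ` F n" by blast
        have "Poly_Mapping.keys (z + x) \<subseteq> {- int (Suc n)..int (Suc n)}"
        proof
          fix k assume "k \<in> Poly_Mapping.keys (z + x)"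
          then have "k \<in> Poly_Mapping.keys z \<or> k \<in> Poly_Mapping.keys x"
            using Poly_Mapping.keys_add[of z x] by blast
          then show "k \<in> {- int (Suc n)..int (Suc n)}"
            using M(1)[of k] n x by (auto simp: coeff_box_def)
        qed
        moreover have "\<bar>Poly_Mapping.lookup (z + x) k\<bar> \<le> int (N n + Suc n)" for k
        proof -
          have "\<bar>Poly_Mapping.lookup x k\<bar> \<le> int (N n)" using x by (simp add: coeff_box_def)
          then show ?thesis using M(2)[of k] n by (simp add: lookup_add)
        qed
        ultimately show "z + x \<in> F n" using x z H(2) by (simp add: F_def coeff_box_def)
      qed
      then have "card ((+) z ` ?B) \<le> card (F n \<inter> (+) z ` F n)" using fin by (intro card_mono) auto
      then have "real (card ?B) \<le> real (card (F n \<inter> (+) z ` F n))" by (simp add: card_image)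
      moreover have "real (card (F n)) / (1 + 1 / real (Suc n)) \<le> real (card ?B)"
        using N[of n] by (simp add: F_def pos_divide_le_eq mult.commute add_pos_pos)
      ultimately have "real (card (F n)) / (1 + 1 / real (Suc n)) \<le> real (card (F n \<inter> (+) z ` F n))"
        by (rule order_trans[rotated])
      then show ?thesis unfolding pos_le_divide_eq[OF card] by simp
    qed
    then show "\<forall>\<^sub>F n in sequentially. 1 / (1 + 1 / real (Suc n)) \<le> real (card (F n \<inter> (+) z ` F n)) / real (card (F n))"
      by (auto simp: eventually_sequentially)
    show "(\<lambda>n. 1 / (1 + 1 / real (Suc n))) \<longlonglongrightarrow> 1"
      using tendsto_inverse[OF tendsto_add[OF tendsto_const LIMSEQ_inverse_real_of_nat], of 1]
      by (simp add: inverse_eq_divide)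
  qed auto
  show ?thesis
  proof (intro exI[of _ F] conjI allI ballI)
    show "F n \<subseteq> H" for n by (auto simp: F_def coeff_box_def)
  qed (simp_all add: fin ne lim)
qed

section \<open>The wreath product\<close>

lemma wreath_add [simp]: "Wreath x n + Wreath y m = Wreath (x + shift n y) (n + m)"
  and wreath_minus [simp]: "- Wreath x n = Wreath (shift (- n) (- x)) (- n)"
  and wreath_diff [simp]: "Wreath x n - Wreath y m = Wreath (x - shift (n - m) y) (n - m)"
  by (simp_all add: plus_wreath_def uminus_wreath_def minus_wreath_def shift_uminus shift_shift)

lemma wreath_cocycle_Wreath [simp]:
  "wreath_cocycle \<theta> (Wreath x n) (Wreath y m) = base_cocycle \<theta> x (shift n y)"
  by (simp add: wreath_cocycle_def)

text \<open>
  For \<open>n \<noteq> 0\<close> conjugating \<open>(x, n)\<close> by the lamp configuration \<open>a\<delta>\<^sub>0\<close> changes the entry at 0 by \<open>a\<close>.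
\<close>

lemma infinite_lamp_orbit:
  assumes "g \<notin> range (\<lambda>x. Wreath x 0)"
  shows "infinite ((\<lambda>k. k + g - k) ` range (\<lambda>x. Wreath x 0))"
proof -
  obtain x n where g: "g = Wreath x n" by (cases g)
  have n: "n \<noteq> 0" using assms g by auto
  define k where "k a = Wreath (Poly_Mapping.single 0 a) 0" for a :: int
  have entry: "Poly_Mapping.lookup (wreath_base (k a + g - k a)) 0 = a + Poly_Mapping.lookup x 0" for a
    using n by (simp add: g k_def lookup_add lookup_minus lookup_single)
  have "inj (\<lambda>a. k a + g - k a)"
  proof (rule injI)
    fix a b assume "k a + g - k a = k b + g - k b"
    then show "a = b" using entry[of a] entry[of b] by (metis add_right_cancel)
  qed
  then have "infinite (range (\<lambda>a. k a + g - k a))" using finite_imageD infinite_UNIV_int by blast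
  moreover have "range (\<lambda>a. k a + g - k a) \<subseteq> (\<lambda>k. k + g - k) ` range (\<lambda>x. Wreath x 0)"
    by (auto simp: k_def)
  ultimately show ?thesis using infinite_super by blast
qed

lemma conjugacy_class_int_sum: "conjugacy_class (x :: int_sum) = {x}"
  by (auto simp: conjugacy_class_def)

text \<open>In an abelian group all conjugacy classes are singletons, hence finite.\<close>

lemma kleppner_base_iff:
  "kleppner (base_cocycle \<theta>) \<longleftrightarrow>
    (\<forall>x. x \<noteq> 0 \<longrightarrow> (\<exists>y. base_cocycle \<theta> x y \<noteq> base_cocycle \<theta> y x))"
  by (auto simp: kleppner_def conjugacy_class_int_sum regular_element_def add.commute)

lemma wreath_averages:
  assumes \<theta>: "\<And>j k. j < k \<Longrightarrow> \<theta> j k = t (nat (k - j))" and "kleppner (base_cocycle \<theta>)"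
  shows "\<exists>K. reduced_cstar (wreath_cocycle \<theta>) \<subseteq>
    twisted_group.averages_to_trace (wreath_cocycle \<theta>) K"
proof -
  interpret twisted_group "wreath_cocycle \<theta>"
    by unfold_locales (rule cocycle_wreath_cocycle[of \<theta> t, OF \<theta>])
  show ?thesis
  proof (rule exI, rule AR_averages_to_trace)
    fix z assume z: "z \<in> range (\<lambda>x. Wreath x 0)" "z \<noteq> 0"
    then obtain x where x: "z = Wreath x 0" by blast
    with z have "x \<noteq> 0" by (auto simp: zero_wreath_def)
    then obtain y where "base_cocycle \<theta> x y \<noteq> base_cocycle \<theta> y x"
      using assms(2) by (auto simp: kleppner_base_iff)
    then show "\<exists>k\<in>range (\<lambda>x. Wreath x 0). wreath_cocycle \<theta> k z \<noteq> wreath_cocycle \<theta> z k"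
      by (intro bexI[of _ "Wreath y 0"]) (auto simp: x)
  next
    fix g k assume "k \<in> range (\<lambda>x. Wreath x 0)"
    then show "g + k - g \<in> range (\<lambda>x. Wreath x 0)" by (cases g) auto
  qed (use infinite_lamp_orbit in \<open>auto simp: zero_wreath_def add.commute\<close>)
qed

definition double :: "int_sum \<Rightarrow> int_sum" where
  "double x = x + x"

lemma double_diff: "double (x - y) = double x - double y"
  and double_add: "double (x + y) = double x + double y"
  and shift_double: "shift n (double x) = double (shift n x)"
  by (simp_all only: double_def shift_add add_diff_add add.commute add.left_commute add.assoc)

lemma inj_double: "inj double"
proof (rule injI)
  fix x y :: int_sum assume "double x = double y"
  then have "Poly_Mapping.lookup x k + Poly_Mapping.lookup x k =
      Poly_Mapping.lookup y k + Poly_Mapping.lookup y k" for k by (metis double_def lookup_add)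
  then have "Poly_Mapping.lookup x k = Poly_Mapping.lookup y k" for k by (smt (verit))
  then show "x = y" by (rule poly_mapping_eqI)
qed

lemma base_cocycle_double:
  "base_cocycle \<theta> (double x) (double y) = base_cocycle \<theta> x y ^ 4"
  unfolding double_def base_cocycle_add_left base_cocycle_add_right by (simp add: power4_eq_xxxx)

text \<open>
  On the radical \<open>S\<close> of the commutator bicharacter the cocycle is symmetric. Write it as
  \<open>e\<^bsup>2\<pi>iB(x,y)\<^esup>\<close> with \<open>B\<close> real bilinear. The shift-invariant function \<open>e\<^bsup>\<pi>iB(x,x)\<^esup>\<close> trivializes it on \<open>S\<close>
  up to the sign \<open>e\<^bsup>\<pi>i(B(x,y) - B(y,x))\<^esup>\<close>. This sign is 1 on \<open>2S\<close>, where the function becomes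
  \<open>q(2x) = \<sigma>(x,x)\<^sup>2\<close>. The trace obtained from \<open>q\<close> differs from the canonical one at every nonzero
  element of \<open>2S\<close>.
\<close>

lemma not_unique_trace_if_not_kleppner:
  assumes \<theta>: "\<And>j k. j < k \<Longrightarrow> \<theta> j k = t (nat (k - j))" and nk: "\<not> kleppner (base_cocycle \<theta>)"
  shows "\<not> unique_trace_property (wreath_cocycle \<theta>)"
proof -
  interpret twisted_group "wreath_cocycle \<theta>"
    by unfold_locales (rule cocycle_wreath_cocycle[of \<theta> t, OF \<theta>])
  let ?B = "base_cocycle \<theta>"
  have B_shift: "?B (shift n x) (shift n y) = ?B x y" for n x y
    by (rule base_cocycle_shift[of \<theta> t, OF \<theta>])
  have B_nz: "?B x y \<noteq> 0" for x y using norm_base_cocycle[of \<theta> x y] by (metis norm_zero zero_neq_one)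
  define S where "S = {x. \<forall>y. ?B x y = ?B y x}"
  have S_sym: "?B x y = ?B y x" if "x \<in> S" for x y using that unfolding S_def by blast
  have S_diff: "x - y \<in> S" if "x \<in> S" "y \<in> S" for x y
    unfolding S_def
  proof (intro CollectI allI)
    fix z
    have "?B (x - y) z * ?B y z = ?B z (x - y) * ?B z y"
      unfolding base_cocycle_add_left[symmetric] base_cocycle_add_right[symmetric]
      using that by (simp add: S_def)
    then show "?B (x - y) z = ?B z (x - y)" using that B_nz[of z y] by (simp add: S_def)
  qed
  have S0: "0 \<in> S" by (simp add: S_def)
  have S_add: "x + y \<in> S" if "x \<in> S" "y \<in> S" for x y
    using S_diff[OF that(1) S_diff[OF S0 that(2)]] by simp
  have S_shift: "shift n x \<in> S" if "x \<in> S" for n x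
    unfolding S_def
  proof (intro CollectI allI)
    fix y
    have "?B (shift n x) (shift n (shift (- n) y)) = ?B (shift n (shift (- n) y)) (shift n x)"
      unfolding B_shift using that by (simp add: S_def)
    then show "?B (shift n x) y = ?B y (shift n x)" by (simp add: shift_shift)
  qed
  define H0 where "H0 = double ` S"
  have H0_S: "H0 \<subseteq> S" unfolding H0_def double_def by (intro image_subsetI S_add)
  have H0_shift: "shift n x \<in> H0" if "x \<in> H0" for n x
    using that S_shift by (auto simp: H0_def shift_double)
  have H0_diff: "x - y \<in> H0" if "x \<in> H0" "y \<in> H0" for x y
  proof -
    obtain a b where "a \<in> S" "b \<in> S" "x = double a" "y = double b" using \<open>x \<in> H0\<close> \<open>y \<in> H0\<close> by (auto simp: H0_def)
    then show ?thesis
      unfolding H0_def by (intro image_eqI[of _ _ "a - b"] S_diff) (simp_all add: double_diff)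
  qed
  have H0_0: "0 \<in> H0" unfolding H0_def by (rule image_eqI[OF _ S0]) (simp add: double_def)
  have H0_add: "x + y \<in> H0" if "x \<in> H0" "y \<in> H0" for x y
    using H0_diff[OF that(1) H0_diff[OF H0_0 that(2)]] by simp
  define q0 where "q0 x = (let y = inv double x in (?B y y)\<^sup>2)" for x
  have q0_double: "q0 (double a) = (?B a a)\<^sup>2" for a by (simp add: q0_def inv_f_f[OF inj_double])
  have q0_norm: "cmod (q0 x) = 1" for x by (simp add: q0_def Let_def norm_power norm_base_cocycle)
  have q0_add: "q0 (x + y) = ?B x y * q0 x * q0 y" if xy: "x \<in> H0" "y \<in> H0" for x y
  proof -
    obtain a b where ab: "a \<in> S" "b \<in> S" "x = double a" "y = double b" using xy by (auto simp: H0_def)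
    have "?B b a = ?B a b" using S_sym[OF ab(1), of b] by (rule sym)
    then show ?thesis
      unfolding ab double_add[symmetric] q0_double base_cocycle_double
      by (simp add: base_cocycle_add_left base_cocycle_add_right power2_eq_square power4_eq_xxxx mult_ac)
  qed
  have q0_shift: "q0 (shift n x) = q0 x" if "x \<in> H0" for n x
    using that by (auto simp: H0_def q0_double shift_double B_shift)
  define E where "E x = Wreath x 0" for x
  define q where "q g = q0 (wreath_base g)" for g
  define \<phi> where "\<phi> = (\<lambda>g. if g \<in> E ` H0 then cnj (q g) else 0)"
  have E_add: "E x + E y = E (x + y)" for x y by (simp add: E_def)
  have inj_E: "inj E" by (auto simp: inj_def E_def)
  have \<phi>_E: "\<phi> (E x) = (if x \<in> H0 then cnj (q0 x) else 0)" for x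
    by (auto simp: \<phi>_def q_def E_def)
  obtain F :: "nat \<Rightarrow> int_sum set" where F: "\<And>n. finite (F n) \<and> F n \<noteq> {} \<and> F n \<subseteq> H0"
    "\<And>z. z \<in> H0 \<Longrightarrow> (\<lambda>n. real (card (F n \<inter> (+) z ` F n)) / real (card (F n))) \<longlonglongrightarrow> 1"
    using exists_folner_sets[OF H0_0 H0_add] by blast
  have trace: "wreath_cocycle \<theta> g h * \<phi> (g + h) = wreath_cocycle \<theta> h g * \<phi> (h + g)" for g h
  proof -
    obtain x n y m where gh: "g = Wreath x n" "h = Wreath y m" by (cases g, cases h)
    show ?thesis
    proof (cases "m = - n")
      case False
      then have "\<phi> (g + h) = 0" "\<phi> (h + g) = 0" by (auto simp: \<phi>_def gh E_def)
      then show ?thesis by simp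
    next
      case True
      define z where "z = shift n y"
      have sum: "g + h = E (x + z)" "h + g = E (shift (- n) (x + z))"
        by (simp_all add: gh True E_def z_def shift_shift shift_add add.commute)
      have coc: "wreath_cocycle \<theta> g h = ?B x z" "wreath_cocycle \<theta> h g = ?B z x"
        using B_shift[of n y "shift (- n) x"] by (simp_all add: gh True z_def shift_shift)
      have mem: "shift (- n) (x + z) \<in> H0 \<longleftrightarrow> x + z \<in> H0"
        using H0_shift[of "x + z" "- n"] H0_shift[of "shift (- n) (x + z)" n] by (auto simp: shift_shift)
      show ?thesis
      proof (cases "x + z \<in> H0")
        case True
        \<comment> \<open>the cocycle is symmetric when one argument lies in \<open>S\<close>, and the factor \<open>\<sigma>(x, x)\<close> cancels\<close>
        then have "?B (x + z) x = ?B x (x + z)" using H0_S S_sym by blast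
        then have "?B z x = ?B x z" using B_nz[of x x] by (simp add: base_cocycle_add_left base_cocycle_add_right)
        then show ?thesis using True by (simp add: sum coc \<phi>_E mem q0_shift)
      qed (simp add: sum \<phi>_E mem)
    qed
  qed
  have "\<exists>\<tau>. tracial_state AR \<tau> \<and> (\<forall>g. \<tau> (u g) = \<phi> g)"
  proof (rule trace_from_folner_sets[where H = "E ` H0" and q = q and F = "\<lambda>n. E ` F n"])
    show "z - w \<in> E ` H0" if "z \<in> E ` H0" "w \<in> E ` H0" for z w
      using that H0_diff by (auto simp: E_def)
    show "cmod (q z) = 1" for z by (simp add: q_def q0_norm)
    show "q (z + w) = wreath_cocycle \<theta> z w * q z * q w" if "z \<in> E ` H0" "w \<in> E ` H0" for z w
      using that q0_add by (auto simp: q_def E_def)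
    show "(\<lambda>n. real (card (E ` F n \<inter> (+) z ` E ` F n)) / real (card (E ` F n))) \<longlonglongrightarrow> 1"
      if "z \<in> E ` H0" for z
    proof -
      obtain x where x: "z = E x" "x \<in> H0" using \<open>z \<in> E ` H0\<close> by blast
      have "(+) z ` E ` F n = E ` ((+) x ` F n)" for n by (simp add: image_image x E_add)
      then have "card (E ` F n \<inter> (+) z ` E ` F n) = card (F n \<inter> (+) x ` F n)" for n
        using inj_E by (simp add: image_Int[symmetric] card_image inj_on_subset)
      then show ?thesis using F(2)[OF x(2)] inj_E by (simp add: card_image inj_on_subset)
    qed
    show "\<phi> = (\<lambda>g. if g \<in> E ` H0 then cnj (q g) else 0)" by (fact \<phi>_def)
  qed (use F(1) trace in auto)
  then obtain \<tau> where \<tau>: "tracial_state AR \<tau>" "\<And>g. \<tau> (u g) = \<phi> g" by blast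
  obtain x where x: "x \<noteq> 0" "x \<in> S" using nk by (auto simp: kleppner_base_iff S_def)
  have "double x \<noteq> 0" using x(1) injD[OF inj_double, of x 0] by (auto simp: double_def)
  then have "canonical_trace (u (E (double x))) = 0"
    by (simp add: canonical_trace_u E_def zero_wreath_def)
  moreover have "double x \<in> H0" using x(2) by (auto simp: H0_def)
  then have "cmod (\<tau> (u (E (double x)))) = 1" by (simp add: \<tau>(2) \<phi>_E q0_norm)
  ultimately have "\<tau> (u (E (double x))) \<noteq> canonical_trace (u (E (double x)))" by auto
  then show ?thesis
    unfolding unique_trace_property_def has_unique_tracial_state_def
    using \<tau>(1) tracial_state_canonical_trace u_in_AR by metis
qed

theorem proposition5p8:
  fixes \<theta> :: "int \<Rightarrow> int \<Rightarrow> real" and t :: "nat \<Rightarrow> real"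
  assumes "\<And>j k. j < k \<Longrightarrow> \<theta> j k \<in> {0..<1}"
    and "\<And>j k. j \<ge> k \<Longrightarrow> \<theta> j k = 0"
    and "\<And>m. m \<ge> 1 \<Longrightarrow> t m \<in> {0..<1}"
    and "\<And>j k. j < k \<Longrightarrow> \<theta> j k = t (nat (k - j))"
  shows "(unique_trace_property (wreath_cocycle \<theta>) \<longleftrightarrow> kleppner (base_cocycle \<theta>)) \<and>
    (kleppner (base_cocycle \<theta>) \<longrightarrow> cstar_simple (wreath_cocycle \<theta>))"
proof -
  interpret twisted_group "wreath_cocycle \<theta>"
    by unfold_locales (rule cocycle_wreath_cocycle[of \<theta> t, OF assms(4)])
  show ?thesis
    using wreath_averages[of \<theta> t] not_unique_trace_if_not_kleppner[of \<theta> t] assms(4)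
      unique_trace_if_averages cstar_simple_if_averages by metis
qed

end
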